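(* Let $(p:M\to B,\Phi_V)$ be a $2$-plectic fibration with a fixed $2$-plectic connection, and suppose that the class $[\partial_C\Phi_V]_2\in H^2(B,H^2(\mathcal V))$ vanishes. Then for any $\alpha_H^\star\in\Omega^1(B,\Omega^2(\mathcal V))$ and $\omega_H^\star\in\Omega^2(B,\Omega^1(\mathcal V))$ satisfying $$\partial_H\Phi_V+\partial_V\alpha_H^\star=0,\qquad \partial_C\Phi_V+\partial_H\alpha_H^\star+\partial_V\omega_H^\star=0,$$ there is a well-defined class $[\partial_H\omega_H^\star+\partial_C\alpha_H^\star]_1\in\Omega^3(B,H^1(\mathcal V))$, which is an obstruction to the existence of a closed extension of $\Phi_V$ with prescribed components $\alpha_H^\star,\omega_H^\star$: if there is a closed $3$-form on $M$ whose components of bidegree $(0,3)$, $(1,2)$, $(2,1)$ are $\Phi_V$, $\alpha_H^\star$, $\omega_H^\star$, then this class vanishes.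
   Context: All objects are smooth. A fibration $p:M\to B$ is a surjective submersion admitting a complete Ehresmann connection. $\mathcal V=\ker dp$, $\Omega^q(\mathcal V)=\Gamma(\wedge^q\mathcal V^* )$, $d_V$ is the vertical de Rham differential. For an Ehresmann connection $TM=\mathcal V\oplus\mathrm{Hor}$, $h$ is the horizontal lift and $C(u,v)=[h(u),h(v)]-h([u,v])$ the curvature. $\Omega^p(B,\Omega^q(\mathcal V))$ is the space of $C^\infty(B)$-multilinear alternating $p$-forms on $\mathfrak X(B)$ with values in $\Omega^q(\mathcal V)$. On $\Theta\in\Omega^p(B,\Omega^q(\mathcal V))$: $\partial_V\Theta=(-1)^pd_V\circ\Theta$; $$(\partial_H\Theta)(v_0,\dots,v_p)=\sum_i(-1)^i\mathcal L_{h(v_i)}\Theta(\dots\widehat{v_i}\dots)+\sum_{i<j}(-1)^{i+j}\Theta([v_i,v_j],\dots\widehat{v_i}\dots\widehat{v_j}\dots);$$ $$(\partial_C\Theta)(v_0,\dots,v_{p+1})=(-1)^p\sum_{i<j}(-1)^{i+j}i_{C(v_i,v_j)}\Theta(\dots\widehat{v_i}\dots\widehat{v_j}\dots).$$ Under the identification $\Omega^k(M)\simeq\bigoplus_{p+q=k}\Omega^p(B,\Omega^q(\mathcal V))$, $\Theta^{(p,q)}(v_1,\dots,v_p)(w_1,\dots,w_q)=\Theta(h(v_1),\dots,h(v_p),w_1,\dots,w_q)$, one has $d=\partial_V+\partial_H+\partial_C$. $\Omega^p(B,H^q(\mathcal V))$ denotes the cohomology of $\partial_V$ at $\Omega^p(B,\Omega^q(\mathcal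 V))$, with classes $[\,\cdot\,]_1$; $\partial_H$ induces a differential on it, whose cohomology is denoted $H^p(B,H^q(\mathcal V))$, with classes $[\,\cdot\,]_2$. A $2$-plectic fibration is a fibration with $\Phi_V\in\Omega^3(\mathcal V)$ such that $d_V\Phi_V=0$ and $i_X\Phi_V=0\Rightarrow X=0$ for $X\in\mathcal V$, which admits a $2$-plectic connection, i.e. one with $\partial_H\Phi_V=0$. For such a connection $\partial_C\Phi_V$ defines a class $[\partial_C\Phi_V]_2\in H^2(B,H^2(\mathcal V))$. *)

theory Defs
  imports
    "HOL-Analysis.Analysis"
    "HOL-Library.Function_Algebras"
    "HOL-Algebra.Coset"
begin

section \<open>Smooth maps between Euclidean spaces\<close>

primrec Ck_on :: "nat \<Rightarrow> 'a::real_normed_vector set \<Rightarrow> ('a \<Rightarrow> 'b::real_normed_vector) \<Rightarrow> bool" where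
  "Ck_on 0 S f \<longleftrightarrow> continuous_on S f"
| "Ck_on (Suc k) S f \<longleftrightarrow> (\<forall>x\<in>S. f differentiable (at x)) \<and>
     (\<forall>v. Ck_on k S (\<lambda>x. frechet_derivative f (at x) v))"

(* Only used for open S in finite-dimensional spaces. *)
definition smooth_on :: "'a::real_normed_vector set \<Rightarrow> ('a \<Rightarrow> 'b::real_normed_vector) \<Rightarrow> bool" where
  "smooth_on S f \<longleftrightarrow> (\<forall>k. Ck_on k S f)"

(* A type 'e satisfying this is a copy of R^n for some n >= 0. The class euclidean_space would
   exclude n = 0. *)
definition euclidean_model :: "'e::real_inner itself \<Rightarrow> bool" where
  "euclidean_model _ \<longleftrightarrow> (\<exists>E :: 'e set. finite E \<and>
     (\<forall>u\<in>E. \<forall>v\<in>E. inner u v = (if u = v then 1 else 0)) \<and> span E = UNIV)"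

lemma euclidean_model_euclidean_space: "euclidean_model TYPE('e::euclidean_space)"
  unfolding euclidean_model_def
  by (rule exI[of _ Basis]) (auto simp: inner_Basis)


section \<open>Manifolds\<close>

type_synonym ('m, 'e) chart = "'m set \<times> ('m \<Rightarrow> 'e)"

(* The underlying point set is the whole (Hausdorff, second countable) type 'm. *)
definition smooth_manifold ::
    "('m::{t2_space, second_countable_topology}, 'e::real_inner) chart set \<Rightarrow> bool" where
  "smooth_manifold A \<longleftrightarrow>
     euclidean_model TYPE('e) \<and>
     (\<Union>(U, \<phi>)\<in>A. U) = UNIV \<and>
     (\<forall>(U, \<phi>)\<in>A. open U \<and> open (\<phi> ` U) \<and> homeomorphism U (\<phi> ` U) \<phi> (inv_into U \<phi>)) \<and>
     (\<forall>(U, \<phi>)\<in>A. \<forall>(V, \<psi>)\<in>A. smooth_on (\<phi> ` (U \<inter> V)) (\<psi> \<circ> inv_into U \<phi>))"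

definition smooth_map ::
    "('m::topological_space, 'e::real_normed_vector) chart set \<Rightarrow>
     ('n::topological_space, 'f::real_normed_vector) chart set \<Rightarrow> ('m \<Rightarrow> 'n) \<Rightarrow> bool" where
  "smooth_map A A' F \<longleftrightarrow> continuous_on UNIV F \<and>
     (\<forall>(U, \<phi>)\<in>A. \<forall>(V, \<psi>)\<in>A'. smooth_on (\<phi> ` (U \<inter> F -` V)) (\<psi> \<circ> F \<circ> inv_into U \<phi>))"

definition smooth_functions :: "('m, 'e::real_normed_vector) chart set \<Rightarrow> ('m \<Rightarrow> real) set" where
  "smooth_functions A = {f. \<forall>(U, \<phi>)\<in>A. smooth_on (\<phi> ` U) (f \<circ> inv_into U \<phi>)}"

type_synonym 'm tangent_vector = "('m \<Rightarrow> real) \<Rightarrow> real"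

(* Derivations at x of the algebra of smooth functions; the value 0 outside that algebra makes
   equality of tangent vectors equality of functions. *)
definition tangent_space ::
    "('m, 'e::real_normed_vector) chart set \<Rightarrow> 'm \<Rightarrow> 'm tangent_vector set" where
  "tangent_space A x = {u.
     (\<forall>f\<in>smooth_functions A. \<forall>g\<in>smooth_functions A. \<forall>a b.
        u (\<lambda>y. a * f y + b * g y) = a * u f + b * u g) \<and>
     (\<forall>f\<in>smooth_functions A. \<forall>g\<in>smooth_functions A.
        u (\<lambda>y. f y * g y) = f x * u g + g x * u f) \<and>
     (\<forall>f. f \<notin> smooth_functions A \<longrightarrow> u f = 0)}"

definition velocity ::
    "('m, 'e::real_normed_vector) chart set \<Rightarrow> (real \<Rightarrow> 'm) \<Rightarrow> real \<Rightarrow> 'm tangent_vector" where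
  "velocity A c t = (\<lambda>f. if f \<in> smooth_functions A then deriv (f \<circ> c) t else 0)"

type_synonym 'm vfield = "'m \<Rightarrow> 'm tangent_vector"

definition vector_fields :: "('m, 'e::real_normed_vector) chart set \<Rightarrow> 'm vfield set" where
  "vector_fields A = {X. (\<forall>x. X x \<in> tangent_space A x) \<and>
     (\<forall>f\<in>smooth_functions A. (\<lambda>x. X x f) \<in> smooth_functions A)}"

definition bracket :: "'m vfield \<Rightarrow> 'm vfield \<Rightarrow> 'm vfield" where
  "bracket X Y = (\<lambda>x f. X x (\<lambda>y. Y y f) - Y x (\<lambda>y. X y f))"

definition scale_field :: "('m \<Rightarrow> real) \<Rightarrow> 'm vfield \<Rightarrow> 'm vfield" where
  "scale_field f X = (\<lambda>x g. f x * X x g)"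


section \<open>Alternating multilinear maps and the Koszul formula\<close>

(* Alternating maps in k arguments from L to C, linear over the scalars R acting by sL and sC.
   The arguments form a list; outside lists of length k over L the value is 0. *)
definition alternating_maps ::
    "'r set \<Rightarrow> ('r \<Rightarrow> 'a \<Rightarrow> 'a) \<Rightarrow> 'a::plus set \<Rightarrow> ('r \<Rightarrow> 'c \<Rightarrow> 'c) \<Rightarrow> 'c::{plus, zero} set \<Rightarrow> nat \<Rightarrow>
     ('a list \<Rightarrow> 'c) set" where
  "alternating_maps R sL L sC C k = {F.
     (\<forall>xs. length xs = k \<and> set xs \<subseteq> L \<longrightarrow> F xs \<in> C) \<and>
     (\<forall>xs. \<not> (length xs = k \<and> set xs \<subseteq> L) \<longrightarrow> F xs = 0) \<and>
     (\<forall>xs i a b. length xs = k \<and> set xs \<subseteq> L \<and> i < k \<and> a \<in> L \<and> b \<in> L \<longrightarrow>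
        F (xs[i := a + b]) = F (xs[i := a]) + F (xs[i := b])) \<and>
     (\<forall>xs i r a. length xs = k \<and> set xs \<subseteq> L \<and> i < k \<and> r \<in> R \<and> a \<in> L \<longrightarrow>
        F (xs[i := sL r a]) = sC r (F (xs[i := a]))) \<and>
     (\<forall>xs i j. length xs = k \<and> set xs \<subseteq> L \<and> i < j \<and> j < k \<and> xs ! i = xs ! j \<longrightarrow> F xs = 0)}"

definition omit :: "nat \<Rightarrow> 'a list \<Rightarrow> 'a list" where
  "omit i xs = take i xs @ drop (Suc i) xs"

type_synonym 'm form = "'m vfield list \<Rightarrow> 'm \<Rightarrow> real"

definition koszul :: "'m vfield set \<Rightarrow> 'm form \<Rightarrow> 'm form" where
  "koszul L \<eta> = (\<lambda>ws x. if set ws \<subseteq> L then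
       (\<Sum>i<length ws. (-1) ^ i * (ws ! i) x (\<eta> (omit i ws))) +
       (\<Sum>j<length ws. \<Sum>i<j.
          (-1) ^ (i + j) * \<eta> (bracket (ws ! i) (ws ! j) # omit i (omit j ws)) x)
     else 0)"

(* Lie derivative of a form on L, for a field X normalising L. *)
definition lie_derivative :: "'m vfield set \<Rightarrow> 'm vfield \<Rightarrow> 'm form \<Rightarrow> 'm form" where
  "lie_derivative L X \<eta> = (\<lambda>ws x. if set ws \<subseteq> L then
       X x (\<eta> ws) - (\<Sum>i<length ws. \<eta> (ws[i := bracket X (ws ! i)]) x)
     else 0)"

definition interior_product :: "'m vfield \<Rightarrow> 'm form \<Rightarrow> 'm form" where
  "interior_product X \<eta> = (\<lambda>ws. \<eta> (X # ws))"

definition differential_forms ::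
    "('m, 'e::real_normed_vector) chart set \<Rightarrow> nat \<Rightarrow> 'm form set" where
  "differential_forms A k =
     alternating_maps (smooth_functions A) scale_field (vector_fields A) (*) (smooth_functions A) k"

definition exterior_derivative ::
    "('m, 'e::real_normed_vector) chart set \<Rightarrow> 'm form \<Rightarrow> 'm form" where
  "exterior_derivative A = koszul (vector_fields A)"


section \<open>Fibrations and Ehresmann connections\<close>

record ('m, 'e, 'b, 'f) fibred =
  total_atlas :: "('m, 'e) chart set"
  base_atlas :: "('b, 'f) chart set"
  proj :: "'m \<Rightarrow> 'b"

definition tangent_map ::
    "('m, 'e, 'b, 'f::real_normed_vector) fibred \<Rightarrow> 'm tangent_vector \<Rightarrow> 'b tangent_vector" where
  "tangent_map F u = (\<lambda>f. if f \<in> smooth_functions (base_atlas F) then u (f \<circ> proj F) else 0)"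

definition vertical_space ::
    "('m, 'e::real_normed_vector, 'b, 'f::real_normed_vector) fibred \<Rightarrow> 'm \<Rightarrow> 'm tangent_vector set" where
  "vertical_space F x = {u \<in> tangent_space (total_atlas F) x. tangent_map F u = 0}"

definition vertical_fields ::
    "('m, 'e::real_normed_vector, 'b, 'f::real_normed_vector) fibred \<Rightarrow> 'm vfield set" where
  "vertical_fields F = {X \<in> vector_fields (total_atlas F). \<forall>x. X x \<in> vertical_space F x}"

definition surjective_submersion ::
    "('m::{t2_space, second_countable_topology}, 'e::real_inner,
      'b::{t2_space, second_countable_topology}, 'f::real_inner) fibred \<Rightarrow> bool" where
  "surjective_submersion F \<longleftrightarrow>
     smooth_manifold (total_atlas F) \<and> smooth_manifold (base_atlas F) \<and>
     smooth_map (total_atlas F) (base_atlas F) (proj F) \<and> surj (proj F) \<and>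
     (\<forall>x. tangent_map F ` tangent_space (total_atlas F) x = tangent_space (base_atlas F) (proj F x))"

type_synonym 'm distribution = "'m \<Rightarrow> 'm tangent_vector set"

definition hlift ::
    "('m, 'e, 'b, 'f::real_normed_vector) fibred \<Rightarrow> 'm distribution \<Rightarrow> 'b vfield \<Rightarrow> 'm vfield" where
  "hlift F Hor v = (\<lambda>x. THE u. u \<in> Hor x \<and> tangent_map F u = v (proj F x))"

(* The last clause is the smoothness of Hor as a subbundle of TM: the horizontal lifts of local
   frames of TB are local frames of Hor. *)
definition ehresmann_connection ::
    "('m, 'e::real_normed_vector, 'b, 'f::real_normed_vector) fibred \<Rightarrow> 'm distribution \<Rightarrow> bool" where
  "ehresmann_connection F Hor \<longleftrightarrow>
     (\<forall>x. Hor x \<subseteq> tangent_space (total_atlas F) x \<and>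
        0 \<in> Hor x \<and>
        (\<forall>u\<in>Hor x. \<forall>w\<in>Hor x. \<forall>a b. (\<lambda>f. a * u f + b * w f) \<in> Hor x) \<and>
        vertical_space F x \<inter> Hor x = {0} \<and>
        (\<forall>u\<in>tangent_space (total_atlas F) x. \<exists>w\<in>vertical_space F x. \<exists>e\<in>Hor x. u = w + e)) \<and>
     (\<forall>v\<in>vector_fields (base_atlas F). hlift F Hor v \<in> vector_fields (total_atlas F))"

(* It suffices to lift curves defined on the whole line: a smooth curve on a compact interval
   is the restriction of one. *)
definition complete_connection ::
    "('m::topological_space, 'e::real_normed_vector, 'b::topological_space, 'f::real_normed_vector) fibred
     \<Rightarrow> 'm distribution \<Rightarrow> bool" where
  "complete_connection F Hor \<longleftrightarrow>
     (\<forall>c :: real \<Rightarrow> 'b. \<forall>t\<^sub>0 x. smooth_map {(UNIV, id)} (base_atlas F) c \<and> proj F x = c t\<^sub>0 \<longrightarrow>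
        (\<exists>\<gamma> :: real \<Rightarrow> 'm. smooth_map {(UNIV, id)} (total_atlas F) \<gamma> \<and> \<gamma> t\<^sub>0 = x \<and>
           (\<forall>t. proj F (\<gamma> t) = c t \<and> velocity (total_atlas F) \<gamma> t \<in> Hor (\<gamma> t))))"

definition fibration ::
    "('m::{t2_space, second_countable_topology}, 'e::real_inner,
      'b::{t2_space, second_countable_topology}, 'f::real_inner) fibred \<Rightarrow> bool" where
  "fibration F \<longleftrightarrow> surjective_submersion F \<and>
     (\<exists>Hor. ehresmann_connection F Hor \<and> complete_connection F Hor)"

definition curvature ::
    "('m, 'e, 'b, 'f::real_normed_vector) fibred \<Rightarrow> 'm distribution \<Rightarrow> 'b vfield \<Rightarrow> 'b vfield \<Rightarrow> 'm vfield"
    where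
  "curvature F Hor u v =
     bracket (hlift F Hor u) (hlift F Hor v) - hlift F Hor (bracket u v)"


section \<open>Bigraded forms\<close>

definition vertical_forms ::
    "('m, 'e::real_normed_vector, 'b, 'f::real_normed_vector) fibred \<Rightarrow> nat \<Rightarrow> 'm form set" where
  "vertical_forms F q =
     alternating_maps (smooth_functions (total_atlas F)) scale_field (vertical_fields F)
       (*) (smooth_functions (total_atlas F)) q"

definition vertical_d ::
    "('m, 'e::real_normed_vector, 'b, 'f::real_normed_vector) fibred \<Rightarrow> 'm form \<Rightarrow> 'm form" where
  "vertical_d F = koszul (vertical_fields F)"

type_synonym ('b, 'm) biform = "'b vfield list \<Rightarrow> 'm form"

definition biforms ::
    "('m, 'e::real_normed_vector, 'b, 'f::real_normed_vector) fibred \<Rightarrow> nat \<Rightarrow> nat \<Rightarrow>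
     ('b, 'm) biform set" where
  "biforms F p q =
     alternating_maps (smooth_functions (base_atlas F)) scale_field (vector_fields (base_atlas F))
       (\<lambda>f \<eta> ws. (f \<circ> proj F) * \<eta> ws) (vertical_forms F q) p"

(* Identification of vertical forms with biforms of horizontal degree 0. *)
definition vform :: "'m form \<Rightarrow> ('b, 'm) biform" where
  "vform \<eta> = (\<lambda>vs. if vs = [] then \<eta> else 0)"

(* The argument p of partial_V and partial_C is the horizontal degree of \<Theta>. *)
definition partial_V ::
    "('m, 'e::real_normed_vector, 'b, 'f::real_normed_vector) fibred \<Rightarrow> nat \<Rightarrow>
     ('b, 'm) biform \<Rightarrow> ('b, 'm) biform" where
  "partial_V F p \<Theta> = (\<lambda>vs ws x. (-1) ^ p * vertical_d F (\<Theta> vs) ws x)"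

definition partial_H ::
    "('m, 'e::real_normed_vector, 'b, 'f::real_normed_vector) fibred \<Rightarrow> 'm distribution \<Rightarrow>
     ('b, 'm) biform \<Rightarrow> ('b, 'm) biform" where
  "partial_H F Hor \<Theta> = (\<lambda>vs ws x. if set vs \<subseteq> vector_fields (base_atlas F) then
       (\<Sum>i<length vs. (-1) ^ i *
          lie_derivative (vertical_fields F) (hlift F Hor (vs ! i)) (\<Theta> (omit i vs)) ws x) +
       (\<Sum>j<length vs. \<Sum>i<j.
          (-1) ^ (i + j) * \<Theta> (bracket (vs ! i) (vs ! j) # omit i (omit j vs)) ws x)
     else 0)"

definition partial_C ::
    "('m, 'e::real_normed_vector, 'b, 'f::real_normed_vector) fibred \<Rightarrow> 'm distribution \<Rightarrow> nat \<Rightarrow>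
     ('b, 'm) biform \<Rightarrow> ('b, 'm) biform" where
  "partial_C F Hor p \<Theta> = (\<lambda>vs ws x. if set vs \<subseteq> vector_fields (base_atlas F) then
       (-1) ^ p * (\<Sum>j<length vs. \<Sum>i<j. (-1) ^ (i + j) *
          interior_product (curvature F Hor (vs ! i) (vs ! j)) (\<Theta> (omit i (omit j vs))) ws x)
     else 0)"

definition component ::
    "('m, 'e::real_normed_vector, 'b, 'f::real_normed_vector) fibred \<Rightarrow> 'm distribution \<Rightarrow>
     nat \<Rightarrow> nat \<Rightarrow> 'm form \<Rightarrow> ('b, 'm) biform" where
  "component F Hor p q \<Phi> = (\<lambda>vs ws.
     if length vs = p \<and> set vs \<subseteq> vector_fields (base_atlas F) \<and>
        length ws = q \<and> set ws \<subseteq> vertical_fields F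
     then \<Phi> (map (hlift F Hor) vs @ ws) else 0)"


section \<open>Cohomology\<close>

definition additive_group :: "'a::{plus, zero} set \<Rightarrow> 'a monoid" where
  "additive_group S = \<lparr>carrier = S, mult = (+), one = 0\<rparr>"

definition Z1 ::
    "('m, 'e::real_normed_vector, 'b, 'f::real_normed_vector) fibred \<Rightarrow> nat \<Rightarrow> nat \<Rightarrow>
     ('b, 'm) biform set" where
  "Z1 F p q = {\<Theta> \<in> biforms F p q. partial_V F p \<Theta> = 0}"

definition B1 ::
    "('m, 'e::real_normed_vector, 'b, 'f::real_normed_vector) fibred \<Rightarrow> nat \<Rightarrow> nat \<Rightarrow>
     ('b, 'm) biform set" where
  "B1 F p q = (if q = 0 then {0} else partial_V F p ` biforms F p (q - 1))"

(* E1 F p q is Omega^p(B, H^q(V)), E2 F Hor p q is H^p(B, H^q(V)). *)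
definition E1 ::
    "('m, 'e::real_normed_vector, 'b, 'f::real_normed_vector) fibred \<Rightarrow> nat \<Rightarrow> nat \<Rightarrow>
     ('b, 'm) biform set monoid" where
  "E1 F p q = additive_group (Z1 F p q) Mod B1 F p q"

definition class1 ::
    "('m, 'e::real_normed_vector, 'b, 'f::real_normed_vector) fibred \<Rightarrow> nat \<Rightarrow> nat \<Rightarrow>
     ('b, 'm) biform \<Rightarrow> ('b, 'm) biform set" where
  "class1 F p q \<Theta> = B1 F p q #>\<^bsub>additive_group (Z1 F p q)\<^esub> \<Theta>"

(* All members of the union are the same coset. *)
definition d1 ::
    "('m, 'e::real_normed_vector, 'b, 'f::real_normed_vector) fibred \<Rightarrow> 'm distribution \<Rightarrow>
     nat \<Rightarrow> nat \<Rightarrow> ('b, 'm) biform set \<Rightarrow> ('b, 'm) biform set" where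
  "d1 F Hor p q c = (\<Union>\<Theta>\<in>c. class1 F (p + 1) q (partial_H F Hor \<Theta>))"

definition Z2 ::
    "('m, 'e::real_normed_vector, 'b, 'f::real_normed_vector) fibred \<Rightarrow> 'm distribution \<Rightarrow>
     nat \<Rightarrow> nat \<Rightarrow> ('b, 'm) biform set set" where
  "Z2 F Hor p q = {c \<in> carrier (E1 F p q). d1 F Hor p q c = \<one>\<^bsub>E1 F (p + 1) q\<^esub>}"

definition B2 ::
    "('m, 'e::real_normed_vector, 'b, 'f::real_normed_vector) fibred \<Rightarrow> 'm distribution \<Rightarrow>
     nat \<Rightarrow> nat \<Rightarrow> ('b, 'm) biform set set" where
  "B2 F Hor p q = (if p = 0 then {\<one>\<^bsub>E1 F p q\<^esub>}
     else d1 F Hor (p - 1) q ` carrier (E1 F (p - 1) q))"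

definition E2 ::
    "('m, 'e::real_normed_vector, 'b, 'f::real_normed_vector) fibred \<Rightarrow> 'm distribution \<Rightarrow>
     nat \<Rightarrow> nat \<Rightarrow> ('b, 'm) biform set set monoid" where
  "E2 F Hor p q = (E1 F p q)\<lparr>carrier := Z2 F Hor p q\<rparr> Mod B2 F Hor p q"

definition class2 ::
    "('m, 'e::real_normed_vector, 'b, 'f::real_normed_vector) fibred \<Rightarrow> 'm distribution \<Rightarrow>
     nat \<Rightarrow> nat \<Rightarrow> ('b, 'm) biform \<Rightarrow> ('b, 'm) biform set set" where
  "class2 F Hor p q \<Theta> =
     B2 F Hor p q #>\<^bsub>(E1 F p q)\<lparr>carrier := Z2 F Hor p q\<rparr>\<^esub> class1 F p q \<Theta>"


section \<open>2-plectic fibrations\<close>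

definition two_plectic_connection ::
    "('m, 'e::real_normed_vector, 'b, 'f::real_normed_vector) fibred \<Rightarrow> 'm form \<Rightarrow>
     'm distribution \<Rightarrow> bool" where
  "two_plectic_connection F \<Phi>\<^sub>V Hor \<longleftrightarrow>
     ehresmann_connection F Hor \<and> partial_H F Hor (vform \<Phi>\<^sub>V) = 0"

(* Nondegeneracy is required at every point x, for the value at x of a vertical field X. *)
definition two_plectic_fibration ::
    "('m::{t2_space, second_countable_topology}, 'e::real_inner,
      'b::{t2_space, second_countable_topology}, 'f::real_inner) fibred \<Rightarrow> 'm form \<Rightarrow> bool" where
  "two_plectic_fibration F \<Phi>\<^sub>V \<longleftrightarrow>
     fibration F \<and> \<Phi>\<^sub>V \<in> vertical_forms F 3 \<and> vertical_d F \<Phi>\<^sub>V = 0 \<and>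
     (\<forall>x. \<forall>X\<in>vertical_fields F.
        (\<forall>Y\<in>vertical_fields F. \<forall>Z\<in>vertical_fields F. \<Phi>\<^sub>V [X, Y, Z] x = 0) \<longrightarrow> X x = 0) \<and>
     (\<exists>Hor. two_plectic_connection F \<Phi>\<^sub>V Hor)"

end

theory Submission
  imports Defs
begin

text \<open>Write \<open>L\<close> for the Lie derivative. The equation \<open>\<partial>\<^sub>C\<Phi> + \<partial>\<^sub>H\<alpha> + \<partial>\<^sub>V\<omega> = 0\<close> determines the
  vertical differential of each \<open>\<omega>(u, v)\<close>. Applying \<open>d\<^sub>V\<close> to \<open>\<partial>\<^sub>H\<omega> + \<partial>\<^sub>C\<alpha>\<close>, commuting it with the Lie
  derivatives along horizontal lifts and using \<open>d\<^sub>V i\<^sub>C = L\<^sub>C\<close> on the vertically closed \<open>\<alpha>\<close>, the terms in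
  \<open>\<alpha>\<close> cancel by \<open>[h(u), h(v)] = h([u, v]) + C(u, v)\<close> and the Jacobi identity, and those in \<open>\<Phi>\<close> by
  the Bianchi identity for the curvature \<open>C\<close>. If the three forms are components of a closed form \<open>\<Psi>\<close> on
  the total space, then evaluating \<open>d\<Psi> = 0\<close> on three horizontal lifts and one vertical field exhibits
  \<open>\<partial>\<^sub>H\<omega> + \<partial>\<^sub>C\<alpha>\<close> as minus \<open>\<partial>\<^sub>V\<close> of the \<open>(3, 0)\<close> component of \<open>\<Psi>\<close>.\<close>

section \<open>Calculus of smooth maps\<close>

text \<open>The formal source of the argument is \<open>d \<circ> d = 0\<close>. By the two
  equations and the closedness of \<Phi>, the differential of the sum of \<Phi>, \<alpha> and
  \<omega> has components only in bidegrees (3, 1) and (4, 0); the (3, 2) component of its own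
  differential is \<open>partial_V\<close> of the (3, 1) part, so that part is vertically closed.
  The proof realises this on values: every operator is evaluated on explicit short lists of vector
  fields, where it is a finite sum, and the required relations become instances of the Jacobi
  identity. The main obstacle is linearity over functions. A class in \<open>E1\<close> requires a
  member of \<open>biforms\<close>, but single terms of \<open>partial_H\<close> are not linear over
  functions on the base: derivatives of the coefficient must cancel between Lie derivatives and
  bracket terms. Such coefficients act through \<open>f \<circ> proj F\<close>, whose smoothness
  rests on the chain rule for \<open>Ck_on\<close>. Forms are 0 on argument lists of the wrong
  length or with foreign entries, so identities between forms have to be checked there as
  well.\<close>

lemma Ck_on_cong:
  assumes "open S" "\<And>x. x \<in> S \<Longrightarrow> f x = g x" "Ck_on k S f"
  shows "Ck_on k S g"
  using assms(2,3)
proof (induction k arbitrary: f g)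
  case 0
  then show ?case by (metis Ck_on.simps(1) continuous_on_cong)
next
  case (Suc k)
  have "g differentiable (at x)" if "x \<in> S" for x
    using Suc.prems that assms(1) unfolding Ck_on.simps differentiable_def
    by (meson has_derivative_transform_within_open)
  moreover have "frechet_derivative f (at x) = frechet_derivative g (at x)" if "x \<in> S" for x
    using Suc.prems that assms(1) frechet_derivative_transform_within_open[of f x S g] by auto
  ultimately show ?case
    using Suc.IH[of "\<lambda>x. frechet_derivative f (at x) v" "\<lambda>x. frechet_derivative g (at x) v" for v]
      Suc.prems by auto
qed

text \<open>Allows the derivative to be given by any formula, for instance the product rule, in
  place of \<open>frechet_derivative\<close>.\<close>

lemma Ck_on_SucI:
  assumes "open S" "\<And>x. x \<in> S \<Longrightarrow> (f has_derivative f' x) (at x)"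
    and "\<And>v. Ck_on k S (\<lambda>x. f' x v)"
  shows "Ck_on (Suc k) S f"
proof -
  have "frechet_derivative f (at x) = f' x" if "x \<in> S" for x
    using assms(2)[OF that] frechet_derivative_at by metis
  then have "Ck_on k S (\<lambda>x. frechet_derivative f (at x) v)" for v
    using Ck_on_cong[OF assms(1) _ assms(3), of v "\<lambda>x. frechet_derivative f (at x) v"] by simp
  then show ?thesis
    using assms(2) by (auto simp: differentiable_def)
qed

lemma Ck_on_has_derivative:
  assumes "Ck_on (Suc k) S f" "x \<in> S"
  shows "(f has_derivative frechet_derivative f (at x)) (at x)"
  using assms frechet_derivative_works by auto

lemma Ck_on_Suc_imp: "Ck_on (Suc k) S f \<Longrightarrow> Ck_on k S f"
proof (induction k arbitrary: f)
  case 0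
  then show ?case
    by (auto intro!: continuous_at_imp_continuous_on differentiable_imp_continuous_within)
next
  case (Suc k)
  then show ?case by (metis Ck_on.simps(2))
qed

text \<open>Derivatives in \<open>Ck_on\<close> are taken \<open>at x\<close>, independently of the
  set, so locality only has to be seen for continuity. It is needed because one chart of the total
  space may meet the preimages of many charts of the base.\<close>

lemma Ck_on_local:
  assumes "\<And>x. x \<in> S \<Longrightarrow> \<exists>T. open T \<and> x \<in> T \<and> Ck_on k T f"
  shows "Ck_on k S f"
  using assms
proof (induction k arbitrary: f)
  case 0
  then show ?case
    by (auto intro!: continuous_at_imp_continuous_on simp: continuous_on_eq_continuous_at) 
      (metis continuous_on_eq_continuous_at)
next
  case (Suc k)
  show ?case
    unfolding Ck_on.simps
  proof (intro conjI ballI allI)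
    fix x assume "x \<in> S"
    then show "f differentiable (at x)" using Suc.prems by fastforce
  next
    fix v
    show "Ck_on k S (\<lambda>x. frechet_derivative f (at x) v)"
      by (rule Suc.IH) (use Suc.prems in fastforce)
  qed
qed

section \<open>Sums, products and composition\<close>

lemma Ck_on_const: "Ck_on k S (\<lambda>_. c)"
  by (induction k arbitrary: c) auto

lemma Ck_on_add: "open S \<Longrightarrow> Ck_on k S f \<Longrightarrow> Ck_on k S g \<Longrightarrow> Ck_on k S (\<lambda>x. f x + g x)"
proof (induction k arbitrary: f g)
  case 0
  then show ?case by (auto intro: continuous_on_add)
next
  case (Suc k)
  show ?case
    by (rule Ck_on_SucI[OF \<open>open S\<close> has_derivative_add])
      (use Suc in \<open>auto intro: Ck_on_has_derivative[of k S]\<close>)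
qed

lemma Ck_on_sum:
  assumes "open S" "\<And>i. i \<in> I \<Longrightarrow> Ck_on k S (f i)"
  shows "Ck_on k S (\<lambda>x. \<Sum>i\<in>I. f i x)"
  using assms by (induction I rule: infinite_finite_induct) (auto intro: Ck_on_add Ck_on_const)

lemma Ck_on_mult:
  fixes f g :: "'a::real_normed_vector \<Rightarrow> real"
  shows "open S \<Longrightarrow> Ck_on k S f \<Longrightarrow> Ck_on k S g \<Longrightarrow> Ck_on k S (\<lambda>x. f x * g x)"
proof (induction k arbitrary: f g)
  case 0
  then show ?case by (auto intro: continuous_on_mult)
next
  case (Suc k)
  \<comment> \<open>The product rule keeps one factor undifferentiated; the induction hypothesis
    needs that factor at order k.\<close>
  note fg = Suc.prems(2,3)[THEN Ck_on_Suc_imp]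
  show ?case
  proof (rule Ck_on_SucI[OF \<open>open S\<close> has_derivative_mult])
    fix v
    have "Ck_on k S (\<lambda>x. frechet_derivative f (at x) v)" "Ck_on k S (\<lambda>x. frechet_derivative g (at x) v)"
      using Suc.prems by auto
    then show "Ck_on k S (\<lambda>x. f x * frechet_derivative g (at x) v + frechet_derivative f (at x) v * g x)"
      by (intro Ck_on_add Suc.IH \<open>open S\<close> fg)
  qed (use Suc.prems in \<open>auto intro: Ck_on_has_derivative[of k S]\<close>)
qed

lemma Ck_on_inner_left:
  fixes f :: "'a::real_normed_vector \<Rightarrow> 'b::real_inner"
  shows "open S \<Longrightarrow> Ck_on k S f \<Longrightarrow> Ck_on k S (\<lambda>x. inner (f x) c)"
proof (induction k arbitrary: f)
  case 0
  then show ?case by (auto intro!: continuous_intros)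
next
  case (Suc k)
  show ?case
    by (rule Ck_on_SucI[OF \<open>open S\<close> has_derivative_inner_left])
      (use Suc in \<open>auto intro: Ck_on_has_derivative[of k S]\<close>)
qed

text \<open>Spanning gives some coefficients, and pairing with each member of E identifies them as
  inner products.\<close>

lemma orthonormal_span_expansion:
  fixes u :: "'b::real_inner"
  assumes "finite E" "\<forall>u\<in>E. \<forall>v\<in>E. inner u v = (if u = v then 1 else 0)" "span E = UNIV"
  shows "u = (\<Sum>e\<in>E. inner u e *\<^sub>R e)"
proof -
  have "u \<in> range (\<lambda>c. \<Sum>e\<in>E. c e *\<^sub>R e)"
    using span_finite[OF assms(1)] assms(3) by simp
  then obtain c where c: "u = (\<Sum>e\<in>E. c e *\<^sub>R e)" by (rule imageE)
  have "inner u d = c d" if "d \<in> E" for d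
  proof -
    have "inner u d = (\<Sum>e\<in>E. c e * (if e = d then 1 else 0))"
      unfolding c inner_sum_left using assms(2) that by (intro sum.cong) auto
    also have "\<dots> = c d" using that assms(1) by (simp add: if_distrib cong: if_cong)
    finally show ?thesis .
  qed
  then have "(\<Sum>e\<in>E. inner u e *\<^sub>R e) = (\<Sum>e\<in>E. c e *\<^sub>R e)" by (intro sum.cong) auto
  then show ?thesis using c by (rule trans[OF _ sym, rotated])
qed

text \<open>The derivative is encoded by its values at fixed vectors, so the chain rule is expanded in
  an orthonormal basis of the middle space.\<close>

lemma Ck_on_compose:
  fixes f :: "'a::real_normed_vector \<Rightarrow> 'b::real_inner" and g :: "'b \<Rightarrow> real"
  assumes "euclidean_model TYPE('b)" "open S" "f ` S \<subseteq> T"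
    and "Ck_on k S f" "Ck_on k T g"
  shows "Ck_on k S (g \<circ> f)"
  using assms(4,5)
proof (induction k arbitrary: g)
  case 0
  then show ?case
    using assms(3) by (metis Ck_on.simps(1) continuous_on_compose continuous_on_subset)
next
  case (Suc k)
  obtain E :: "'b set" where E: "finite E"
    "\<forall>u\<in>E. \<forall>v\<in>E. inner u v = (if u = v then 1 else 0)" "span E = UNIV"
    using assms(1) unfolding euclidean_model_def by auto
  show ?case
  proof (rule Ck_on_SucI[OF \<open>open S\<close>])
    fix x assume x: "x \<in> S"
    let ?g' = "frechet_derivative g (at (f x))" and ?f' = "frechet_derivative f (at x)"
    have g': "(g has_derivative ?g') (at (f x))"
      using Ck_on_has_derivative[OF Suc.prems(2)] assms(3) x by auto
    have eq: "?g' \<circ> ?f' = (\<lambda>v. \<Sum>e\<in>E. inner (?f' v) e * ?g' e)"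
    proof
      fix v
      have "?g' (?f' v) = ?g' (\<Sum>e\<in>E. inner (?f' v) e *\<^sub>R e)"
        by (subst orthonormal_span_expansion[OF E, symmetric]) simp
      also have "\<dots> = (\<Sum>e\<in>E. inner (?f' v) e * ?g' e)"
        using has_derivative_linear[OF g'] by (simp add: linear_sum linear_cmul)
      finally show "(?g' \<circ> ?f') v = (\<Sum>e\<in>E. inner (?f' v) e * ?g' e)" by simp
    qed
    show "((g \<circ> f) has_derivative (\<lambda>v. \<Sum>e\<in>E. inner (?f' v) e * ?g' e)) (at x)"
      using diff_chain_at[OF Ck_on_has_derivative[OF Suc.prems(1) x] g'] unfolding eq .
  next
    fix v
    have "Ck_on k S (\<lambda>x. frechet_derivative g (at (f x)) e)" for e
      using Suc.IH[of "\<lambda>y. frechet_derivative g (at y) e"] Suc.prems Ck_on_Suc_imp[OF Suc.prems(1)]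
      by (simp add: comp_def)
    then show "Ck_on k S (\<lambda>x. \<Sum>e\<in>E. inner (frechet_derivative f (at x) v) e *
        frechet_derivative g (at (f x)) e)"
      using Suc.prems(1)
      by (intro Ck_on_sum Ck_on_mult Ck_on_inner_left \<open>open S\<close>) auto
  qed
qed


section \<open>The algebra of smooth functions\<close>

lemma smooth_manifold_chartD:
  assumes "smooth_manifold A" "(U, \<phi>) \<in> A"
  shows "open U" "open (\<phi> ` U)" "homeomorphism U (\<phi> ` U) \<phi> (inv_into U \<phi>)"
proof -
  have "\<forall>(U, \<phi>)\<in>A. open U \<and> open (\<phi> ` U) \<and> homeomorphism U (\<phi> ` U) \<phi> (inv_into U \<phi>)"
    using assms(1) unfolding smooth_manifold_def by (elim conjE)
  from bspec[OF this assms(2)]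
  show "open U" "open (\<phi> ` U)" "homeomorphism U (\<phi> ` U) \<phi> (inv_into U \<phi>)" by simp_all
qed

lemma smooth_functions_iff:
  "f \<in> smooth_functions A \<longleftrightarrow> (\<forall>U \<phi> k. (U, \<phi>) \<in> A \<longrightarrow> Ck_on k (\<phi> ` U) (\<lambda>y. f (inv_into U \<phi> y)))"
  unfolding smooth_functions_def smooth_on_def comp_def by blast

lemma smooth_functions_const: "(\<lambda>_. c) \<in> smooth_functions A"
  by (simp add: smooth_functions_iff Ck_on_const)

lemma smooth_functions_add:
  assumes "smooth_manifold A" "f \<in> smooth_functions A" "g \<in> smooth_functions A"
  shows "(\<lambda>x. f x + g x) \<in> smooth_functions A"
  using assms(2,3) smooth_manifold_chartD(2)[OF assms(1)]
  unfolding smooth_functions_iff by (simp add: Ck_on_add)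

lemma smooth_functions_mult:
  assumes "smooth_manifold A" "f \<in> smooth_functions A" "g \<in> smooth_functions A"
  shows "(\<lambda>x. f x * g x) \<in> smooth_functions A"
  using assms(2,3) smooth_manifold_chartD(2)[OF assms(1)]
  unfolding smooth_functions_iff by (simp add: Ck_on_mult)

text \<open>Near each point the coordinate expression of \<open>f \<circ> p\<close> factors through
  a single chart of the base, where \<open>Ck_on_compose\<close> applies; \<open>Ck_on_local\<close>
  then glues.\<close>

lemma smooth_functions_pullback:
  fixes A :: "('m::{t2_space, second_countable_topology}, 'e::real_inner) chart set"
    and B :: "('b::{t2_space, second_countable_topology}, 'f::real_inner) chart set"
  assumes A: "smooth_manifold A" and B: "smooth_manifold B" and p: "smooth_map A B p"
    and f: "f \<in> smooth_functions B"
  shows "f \<circ> p \<in> smooth_functions A"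
proof -
  have "Ck_on k (\<phi> ` U) (f \<circ> p \<circ> inv_into U \<phi>)" if U: "(U, \<phi>) \<in> A" for k U \<phi>
  proof (rule Ck_on_local)
    fix y assume "y \<in> \<phi> ` U"
    then obtain x where x: "x \<in> U" "y = \<phi> x" by auto
    obtain V \<psi> where V: "(V, \<psi>) \<in> B" "p x \<in> V"
    proof -
      have "(\<Union>(V, \<psi>)\<in>B. V) = UNIV" using B unfolding smooth_manifold_def by (elim conjE)
      then have "p x \<in> (\<Union>(V, \<psi>)\<in>B. V)" by simp
      then show ?thesis using that by auto
    qed
    note hU = smooth_manifold_chartD[OF A U] and hV = smooth_manifold_chartD[OF B V(1)]
    \<comment> \<open>\<open>?W\<close> is the part of U that p sends into V; its image under the
      chart is open because p is continuous and the chart is a homeomorphism onto an open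
      set.\<close>
    let ?W = "U \<inter> p -` V" and ?\<phi>' = "inv_into U \<phi>" and ?\<psi>' = "inv_into V \<psi>"
    have "continuous_on UNIV p" using p unfolding smooth_map_def by simp
    then have "open (p -` V)" using hV(1) open_vimage by blast
    then have "openin (top_of_set U) ?W" by (simp add: openin_open_Int)
    then have "openin (top_of_set (\<phi> ` U)) (\<phi> ` ?W)"
      using homeomorphism_imp_open_map[OF hU(3)] by blast
    then have opn: "open (\<phi> ` ?W)" using hU(2) openin_open_trans by blast
    have inj: "?\<phi>' (\<phi> z) = z" if "z \<in> U" for z
      using homeomorphism_apply1[OF hU(3) that] .
    have inj': "?\<psi>' (\<psi> z) = z" if "z \<in> V" for z
      using homeomorphism_apply1[OF hV(3) that] .
    have "Ck_on k (\<phi> ` ?W) ((f \<circ> ?\<psi>') \<circ> (\<psi> \<circ> p \<circ> ?\<phi>'))"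
    proof (rule Ck_on_compose[where T = "\<psi> ` V"])
      show "euclidean_model TYPE('f)" using B unfolding smooth_manifold_def by (elim conjE)
      show "Ck_on k (\<phi> ` ?W) (\<psi> \<circ> p \<circ> ?\<phi>')"
        using p U V(1) unfolding smooth_map_def smooth_on_def by fast
      show "Ck_on k (\<psi> ` V) (f \<circ> ?\<psi>')"
        using f V(1) unfolding smooth_functions_iff comp_def by blast
      show "(\<psi> \<circ> p \<circ> ?\<phi>') ` \<phi> ` ?W \<subseteq> \<psi> ` V" using inj by auto
    qed (rule opn)
    then have "Ck_on k (\<phi> ` ?W) (f \<circ> p \<circ> ?\<phi>')"
      by (rule Ck_on_cong[OF opn, rotated]) (use inj inj' in auto)
    then show "\<exists>T. open T \<and> y \<in> T \<and> Ck_on k T (f \<circ> p \<circ> ?\<phi>')"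
      using opn x V by blast
  qed
  then show ?thesis by (simp add: smooth_functions_iff comp_def)
qed


section \<open>Vector fields\<close>

locale smooth_atlas =
  fixes A :: "('m::{t2_space, second_countable_topology}, 'e::real_inner) chart set"
  assumes smooth_manifold: "smooth_manifold A"
begin

lemma smooth_zero: "0 \<in> smooth_functions A"
  using smooth_functions_const[of 0] by (simp add: zero_fun_def)

lemma smooth_add: "f \<in> smooth_functions A \<Longrightarrow> g \<in> smooth_functions A \<Longrightarrow> f + g \<in> smooth_functions A"
  using smooth_functions_add[OF smooth_manifold] by (simp add: plus_fun_def)

lemma smooth_mult: "f \<in> smooth_functions A \<Longrightarrow> g \<in> smooth_functions A \<Longrightarrow> f * g \<in> smooth_functions A"
  using smooth_functions_mult[OF smooth_manifold] by (simp add: times_fun_def)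

lemma smooth_uminus: "f \<in> smooth_functions A \<Longrightarrow> - f \<in> smooth_functions A"
  using smooth_functions_mult[OF smooth_manifold smooth_functions_const[of "-1"]]
  by (simp add: fun_Compl_def)

lemma smooth_diff: "f \<in> smooth_functions A \<Longrightarrow> g \<in> smooth_functions A \<Longrightarrow> f - g \<in> smooth_functions A"
  using smooth_add[OF _ smooth_uminus] by (metis diff_conv_add_uminus)

lemmas smooth_algebra_fun = smooth_zero smooth_add smooth_mult smooth_uminus smooth_diff

text \<open>Each closure rule in operator form and in lambda form, since smooth functions reach the
  simplifier in both shapes.\<close>

lemmas smooth_algebra = smooth_functions_const smooth_algebra_fun
  smooth_algebra_fun[unfolded zero_fun_def plus_fun_def times_fun_def fun_Compl_def fun_diff_def]

section \<open>Vector fields as derivations\<close>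

lemma field_lincomb:
  assumes "X \<in> vector_fields A" "f \<in> smooth_functions A" "g \<in> smooth_functions A"
  shows "X x (\<lambda>y. a * f y + b * g y) = a * X x f + b * X x g"
  using assms unfolding vector_fields_def tangent_space_def by blast

lemma field_add_fun:
  assumes "X \<in> vector_fields A" "f \<in> smooth_functions A" "g \<in> smooth_functions A"
  shows "X x (f + g) = X x f + X x g"
  using field_lincomb[OF assms, of x 1 1] by (simp add: plus_fun_def)

lemma field_diff_fun:
  assumes "X \<in> vector_fields A" "f \<in> smooth_functions A" "g \<in> smooth_functions A"
  shows "X x (f - g) = X x f - X x g"
  using field_lincomb[OF assms, of x 1 "-1"] by (simp add: fun_diff_def)

lemma field_uminus_fun:
  assumes "X \<in> vector_fields A" "f \<in> smooth_functions A"
  shows "X x (- f) = - X x f"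
  using field_lincomb[OF assms smooth_zero, of x "-1" 0] by (simp add: fun_Compl_def)

lemma field_zero_fun:
  assumes "X \<in> vector_fields A"
  shows "X x 0 = 0"
  using field_lincomb[OF assms smooth_zero smooth_zero, of x 0 0] by (simp add: zero_fun_def)

lemma field_mult_fun:
  assumes "X \<in> vector_fields A" "f \<in> smooth_functions A" "g \<in> smooth_functions A"
  shows "X x (f * g) = f x * X x g + g x * X x f"
  using assms unfolding vector_fields_def tangent_space_def times_fun_def by blast

lemma field_smooth:
  "X \<in> vector_fields A \<Longrightarrow> f \<in> smooth_functions A \<Longrightarrow> (\<lambda>x. X x f) \<in> smooth_functions A"
  unfolding vector_fields_def by blast

lemma field_nonsmooth: "X \<in> vector_fields A \<Longrightarrow> f \<notin> smooth_functions A \<Longrightarrow> X x f = 0"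
  unfolding vector_fields_def tangent_space_def by blast

lemmas field_rules_fun = field_add_fun field_diff_fun field_uminus_fun field_zero_fun field_mult_fun

lemmas field_rules = field_rules_fun
  field_rules_fun[unfolded zero_fun_def plus_fun_def times_fun_def fun_Compl_def fun_diff_def]

lemma vector_fieldI:
  assumes "\<And>x f g a b. f \<in> smooth_functions A \<Longrightarrow> g \<in> smooth_functions A \<Longrightarrow>
      X x (\<lambda>y. a * f y + b * g y) = a * X x f + b * X x g"
    and "\<And>x f g. f \<in> smooth_functions A \<Longrightarrow> g \<in> smooth_functions A \<Longrightarrow>
      X x (\<lambda>y. f y * g y) = f x * X x g + g x * X x f"
    and "\<And>x f. f \<notin> smooth_functions A \<Longrightarrow> X x f = 0"
    and "\<And>f. f \<in> smooth_functions A \<Longrightarrow> (\<lambda>x. X x f) \<in> smooth_functions A"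
  shows "X \<in> vector_fields A"
  unfolding vector_fields_def tangent_space_def using assms by blast

text \<open>Fields vanish on nonsmooth functions by convention, so smooth test functions determine
  them.\<close>

lemma field_eqI:
  assumes "X \<in> vector_fields A" "Y \<in> vector_fields A"
    and "\<And>x f. f \<in> smooth_functions A \<Longrightarrow> X x f = Y x f"
  shows "X = Y"
proof (intro ext)
  show "X x f = Y x f" for x f
    using assms(3) field_nonsmooth[OF assms(1)] field_nonsmooth[OF assms(2)]
    by (cases "f \<in> smooth_functions A") simp_all
qed

section \<open>The Lie algebra of vector fields\<close>

lemma vector_fields_diff:
  assumes X: "X \<in> vector_fields A" and Y: "Y \<in> vector_fields A"
  shows "X - Y \<in> vector_fields A"
  by (rule vector_fieldI)
    (simp_all add: field_lincomb X Y field_rules[OF X] field_rules[OF Y] field_nonsmooth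
      field_smooth smooth_algebra algebra_simps)

lemma vector_fields_zero: "0 \<in> vector_fields A"
  by (rule vector_fieldI) (simp_all add: smooth_algebra)

lemma vector_fields_uminus: "X \<in> vector_fields A \<Longrightarrow> - X \<in> vector_fields A"
  using vector_fields_diff[OF vector_fields_zero] by simp

lemma vector_fields_add:
  "X \<in> vector_fields A \<Longrightarrow> Y \<in> vector_fields A \<Longrightarrow> X + Y \<in> vector_fields A"
  using vector_fields_diff[OF _ vector_fields_uminus] by simp

lemma vector_fields_scale:
  assumes f: "f \<in> smooth_functions A" and X: "X \<in> vector_fields A"
  shows "scale_field f X \<in> vector_fields A"
  by (rule vector_fieldI)
    (simp_all add: scale_field_def f X field_lincomb field_rules[OF X] field_nonsmooth
      field_smooth smooth_algebra algebra_simps)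

text \<open>In the Leibniz rule the mixed products of first derivatives of f and g are symmetric in
  X and Y and cancel in the commutator.\<close>

lemma vector_fields_bracket:
  assumes X: "X \<in> vector_fields A" and Y: "Y \<in> vector_fields A"
  shows "bracket X Y \<in> vector_fields A"
proof (rule vector_fieldI)
  note r = bracket_def X Y field_lincomb field_rules[OF X] field_rules[OF Y] field_nonsmooth
    field_smooth smooth_algebra algebra_simps
  fix x f g a b
  assume f: "f \<in> smooth_functions A" and g: "g \<in> smooth_functions A"
  have "X x (\<lambda>y. Y y (\<lambda>y. a * f y + b * g y)) = a * X x (\<lambda>y. Y y f) + b * X x (\<lambda>y. Y y g)"
    "Y x (\<lambda>y. X y (\<lambda>y. a * f y + b * g y)) = a * Y x (\<lambda>y. X y f) + b * Y x (\<lambda>y. X y g)"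
    by (simp_all add: field_lincomb[OF X] field_lincomb[OF Y] X Y f g field_smooth)
  then show "bracket X Y x (\<lambda>y. a * f y + b * g y) = a * bracket X Y x f + b * bracket X Y x g"
    by (simp add: bracket_def algebra_simps)
  show "bracket X Y x (\<lambda>y. f y * g y) = f x * bracket X Y x g + g x * bracket X Y x f"
    using f g by (simp add: r)
  show "(\<lambda>x. bracket X Y x f) \<in> smooth_functions A" using f by (simp add: r)
next
  fix x f assume "f \<notin> smooth_functions A"
  \<comment> \<open>Both inner functions are constantly 0 by the convention on nonsmooth arguments,
    and a field annihilates the zero function.\<close>
  then show "bracket X Y x f = 0"
    by (simp add: bracket_def X Y field_nonsmooth field_rules[OF X] field_rules[OF Y])
qed

lemmas vector_fields_closed = vector_fields_zero vector_fields_add vector_fields_diff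
  vector_fields_uminus vector_fields_scale vector_fields_bracket

lemma bracket_swap: "bracket Y X = - bracket X Y"
  by (simp add: bracket_def fun_eq_iff)

lemma bracket_add_left:
  assumes X: "X \<in> vector_fields A" and Y: "Y \<in> vector_fields A" and Z: "Z \<in> vector_fields A"
  shows "bracket (X + Y) Z = bracket X Z + bracket Y Z"
  by (rule field_eqI; (simp add: vector_fields_closed field_smooth assms; fail)?)
    (simp add: vector_fields_closed assms bracket_def field_smooth field_rules[OF Z])

lemma bracket_diff_left:
  assumes X: "X \<in> vector_fields A" and Y: "Y \<in> vector_fields A" and Z: "Z \<in> vector_fields A"
  shows "bracket (X - Y) Z = bracket X Z - bracket Y Z"
  by (rule field_eqI; (simp add: vector_fields_closed field_smooth assms; fail)?)
    (simp add: vector_fields_closed assms bracket_def field_smooth field_rules[OF Z])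

lemma bracket_diff_right:
  assumes X: "X \<in> vector_fields A" and Y: "Y \<in> vector_fields A" and Z: "Z \<in> vector_fields A"
  shows "bracket Z (X - Y) = bracket Z X - bracket Z Y"
  using bracket_diff_left[OF assms] bracket_swap[of Z] by simp

lemma bracket_add_right:
  assumes X: "X \<in> vector_fields A" and Y: "Y \<in> vector_fields A" and Z: "Z \<in> vector_fields A"
  shows "bracket Z (X + Y) = bracket Z X + bracket Z Y"
  using bracket_add_left[OF assms] bracket_swap[of Z] by simp

lemma bracket_scale_left:
  assumes X: "X \<in> vector_fields A" and Y: "Y \<in> vector_fields A" and f: "f \<in> smooth_functions A"
  shows "bracket (scale_field f X) Y = scale_field f (bracket X Y) - scale_field (\<lambda>x. Y x f) X"
  by (rule field_eqI; (simp add: vector_fields_closed field_smooth assms; fail)?)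
    (simp add: vector_fields_closed assms bracket_def scale_field_def field_smooth
      field_rules[OF Y] algebra_simps)

lemma bracket_scale_right:
  assumes X: "X \<in> vector_fields A" and Y: "Y \<in> vector_fields A" and f: "f \<in> smooth_functions A"
  shows "bracket X (scale_field f Y) = scale_field f (bracket X Y) + scale_field (\<lambda>x. X x f) Y"
  by (rule field_eqI; (simp add: vector_fields_closed field_smooth assms; fail)?)
    (simp add: vector_fields_closed assms bracket_def scale_field_def field_smooth
      field_rules[OF X] algebra_simps)

text \<open>Written as a derivation rule for \<open>bracket X\<close>, the shape that commuting Lie
  derivatives requires.\<close>

lemma bracket_jacobi:
  assumes X: "X \<in> vector_fields A" and Y: "Y \<in> vector_fields A" and Z: "Z \<in> vector_fields A"
  shows "bracket X (bracket Y Z) = bracket (bracket X Y) Z + bracket Y (bracket X Z)"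
  by (rule field_eqI; (simp add: vector_fields_closed field_smooth assms; fail)?)
    (simp add: vector_fields_closed assms bracket_def field_smooth
      field_rules[OF X] field_rules[OF Y] field_rules[OF Z])

end


section \<open>Alternating maps in low degree\<close>

lemma alternating_maps_closed:
  "F \<in> alternating_maps R sL L sC C k \<Longrightarrow> length xs = k \<Longrightarrow> set xs \<subseteq> L \<Longrightarrow> F xs \<in> C"
  unfolding alternating_maps_def by blast

lemma alternating_maps_outside:
  "F \<in> alternating_maps R sL L sC C k \<Longrightarrow> \<not> (length xs = k \<and> set xs \<subseteq> L) \<Longrightarrow> F xs = 0"
  unfolding alternating_maps_def by blast

context
  fixes R :: "'r set" and sL :: "'r \<Rightarrow> 'a::ab_group_add \<Rightarrow> 'a" and L :: "'a set"
    and sC :: "'r \<Rightarrow> 'c::ab_group_add \<Rightarrow> 'c" and C :: "'c set"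
  assumes L_diff: "\<And>a b. a \<in> L \<Longrightarrow> b \<in> L \<Longrightarrow> a - b \<in> L"
begin

text \<open>The definition updates a list at an index. The pattern \<open>us @ a # vs\<close>
  exposes the slot, so the rules for lists of length 1, 2, 3 are instances.\<close>

lemma alternating_maps_add:
  assumes "F \<in> alternating_maps R sL L sC C k" "length (us @ a # vs) = k"
    "set us \<subseteq> L" "set vs \<subseteq> L" "a \<in> L" "b \<in> L"
  shows "F (us @ (a + b) # vs) = F (us @ a # vs) + F (us @ b # vs)"
proof -
  have "F ((us @ a # vs)[length us := a + b]) =
      F ((us @ a # vs)[length us := a]) + F ((us @ a # vs)[length us := b])"
    using assms unfolding alternating_maps_def by (auto simp del: list_update_length)
  then show ?thesis by simp
qed

lemma alternating_maps_scale:
  assumes "F \<in> alternating_maps R sL L sC C k" "length (us @ a # vs) = k"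
    "set us \<subseteq> L" "set vs \<subseteq> L" "a \<in> L" "r \<in> R"
  shows "F (us @ sL r a # vs) = sC r (F (us @ a # vs))"
proof -
  have "F ((us @ a # vs)[length us := sL r a]) = sC r (F ((us @ a # vs)[length us := a]))"
    using assms unfolding alternating_maps_def by (auto simp del: list_update_length)
  then show ?thesis by simp
qed

lemma alternating_maps_diff:
  assumes "F \<in> alternating_maps R sL L sC C k" "length (us @ a # vs) = k"
    "set us \<subseteq> L" "set vs \<subseteq> L" "a \<in> L" "b \<in> L"
  shows "F (us @ (a - b) # vs) = F (us @ a # vs) - F (us @ b # vs)"
  using alternating_maps_add[of F k us "a - b" vs b] assms L_diff by simp

lemma alternating_maps_uminus:
  assumes "F \<in> alternating_maps R sL L sC C k" "length (us @ a # vs) = k"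
    "set us \<subseteq> L" "set vs \<subseteq> L" "a \<in> L"
  shows "F (us @ (- a) # vs) = - F (us @ a # vs)"
proof -
  have 0: "0 \<in> L" using L_diff[OF assms(5,5)] by simp
  have "F (us @ 0 # vs) = 0"
    using alternating_maps_diff[OF assms assms(5)] by simp
  then show ?thesis
    using alternating_maps_diff[of F k us 0 vs a] assms 0 by simp
qed

text \<open>Polarisation: expand the vanishing value with \<open>a + b\<close> in both neighbouring
  slots.\<close>

lemma alternating_maps_swap:
  assumes F: "F \<in> alternating_maps R sL L sC C k" and k: "length (us @ a # b # vs) = k"
    and L: "set us \<subseteq> L" "set vs \<subseteq> L" "a \<in> L" "b \<in> L"
  shows "F (us @ b # a # vs) = - F (us @ a # b # vs)"
proof -
  have alt: "F (us @ c # c # vs) = 0" if "c \<in> L" for c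
  proof -
    have "(us @ c # c # vs) ! length us = (us @ c # c # vs) ! Suc (length us)"
      by (simp add: nth_append)
    moreover have "length us < Suc (length us)" "Suc (length us) < k"
      "length (us @ c # c # vs) = k" "set (us @ c # c # vs) \<subseteq> L" using k that L by auto
    moreover have "\<forall>xs i j. length xs = k \<and> set xs \<subseteq> L \<and> i < j \<and> j < k \<and> xs ! i = xs ! j \<longrightarrow> F xs = 0"
      using F unfolding alternating_maps_def by blast
    ultimately show ?thesis by blast
  qed
  \<comment> \<open>Only differences are known to stay in L, so the sum is written as
    \<open>a - ((b - b) - b)\<close>.\<close>
  have ab: "a + b \<in> L"
    using L_diff[OF L(3) L_diff[OF L_diff[OF L(4,4)] L(4)]] by simp
  have "0 = F (us @ (a + b) # (a + b) # vs)" using alt[OF ab] by simp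
  also have "\<dots> = F (us @ a # (a + b) # vs) + F (us @ b # (a + b) # vs)"
    using alternating_maps_add[OF F, of us a "(a + b) # vs" b] k L ab by simp
  also have "\<dots> = (F (us @ a # a # vs) + F (us @ a # b # vs)) +
      (F (us @ b # a # vs) + F (us @ b # b # vs))"
    using alternating_maps_add[OF F, of "us @ [a]" a vs b]
      alternating_maps_add[OF F, of "us @ [b]" a vs b] k L by simp
  finally show ?thesis using alt[OF L(3)] alt[OF L(4)] by (simp add: eq_neg_iff_add_eq_0 add.commute)
qed

lemma alternating_maps_1:
  assumes "F \<in> alternating_maps R sL L sC C 1" "a \<in> L" "b \<in> L"
  shows "F [a + b] = F [a] + F [b]" "F [a - b] = F [a] - F [b]" "F [- a] = - F [a]"
  using alternating_maps_add[OF assms(1), of "[]" a "[]" b]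
    alternating_maps_diff[OF assms(1), of "[]" a "[]" b]
    alternating_maps_uminus[OF assms(1), of "[]" a "[]"] assms(2,3) by simp_all

lemma alternating_maps_2:
  assumes "F \<in> alternating_maps R sL L sC C 2" "a \<in> L" "b \<in> L" "c \<in> L"
  shows "F [a + b, c] = F [a, c] + F [b, c]" "F [a - b, c] = F [a, c] - F [b, c]"
    "F [- a, c] = - F [a, c]" "F [c, a + b] = F [c, a] + F [c, b]"
    "F [c, a - b] = F [c, a] - F [c, b]" "F [c, - a] = - F [c, a]"
  using alternating_maps_add[OF assms(1), of "[]" a "[c]" b]
    alternating_maps_diff[OF assms(1), of "[]" a "[c]" b]
    alternating_maps_uminus[OF assms(1), of "[]" a "[c]"]
    alternating_maps_add[OF assms(1), of "[c]" a "[]" b]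
    alternating_maps_diff[OF assms(1), of "[c]" a "[]" b]
    alternating_maps_uminus[OF assms(1), of "[c]" a "[]"] assms(2-) by simp_all

lemma alternating_maps_swap_2:
  assumes "F \<in> alternating_maps R sL L sC C 2" "a \<in> L" "b \<in> L"
  shows "F [b, a] = - F [a, b]"
  using alternating_maps_swap[OF assms(1), of "[]" a b "[]"] assms(2-) by simp

lemma alternating_maps_3:
  assumes "F \<in> alternating_maps R sL L sC C 3" "a \<in> L" "b \<in> L" "c \<in> L" "d \<in> L"
  shows "F [a + b, c, d] = F [a, c, d] + F [b, c, d]" "F [a - b, c, d] = F [a, c, d] - F [b, c, d]"
    "F [- a, c, d] = - F [a, c, d]"
  using alternating_maps_add[OF assms(1), of "[]" a "[c, d]" b]
    alternating_maps_diff[OF assms(1), of "[]" a "[c, d]" b]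
    alternating_maps_uminus[OF assms(1), of "[]" a "[c, d]"] assms(2-) by simp_all

lemma alternating_maps_swap_3:
  assumes "F \<in> alternating_maps R sL L sC C 3" "a \<in> L" "b \<in> L" "c \<in> L"
  shows "F [b, a, c] = - F [a, b, c]" "F [c, b, a] = - F [c, a, b]"
  using alternating_maps_swap[OF assms(1), of "[]" a b "[c]"]
    alternating_maps_swap[OF assms(1), of "[c]" a b "[]"] assms(2-) by simp_all

end

section \<open>Membership criteria in degrees 1 and 3, sums and differences\<close>

lemma alternating_maps_1I:
  assumes "\<And>a. a \<in> L \<Longrightarrow> F [a] \<in> C"
    and "\<And>xs. \<not> (length xs = 1 \<and> set xs \<subseteq> L) \<Longrightarrow> F xs = 0"
    and "\<And>a b. a \<in> L \<Longrightarrow> b \<in> L \<Longrightarrow> F [a + b] = F [a] + F [b]"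
    and "\<And>r a. r \<in> R \<Longrightarrow> a \<in> L \<Longrightarrow> F [sL r a] = sC r (F [a])"
  shows "F \<in> alternating_maps R sL L sC C 1"
  unfolding alternating_maps_def
proof (intro CollectI conjI allI impI; (elim conjE)?)
  fix xs :: "'a list" assume "length xs = 1" "set xs \<subseteq> L"
  then show "F xs \<in> C" using assms(1) by (auto simp: length_Suc_conv)
qed (use assms in \<open>auto simp: length_Suc_conv\<close>)

text \<open>The two adjacent transpositions carry every slot to the first one, so linearity is only
  demanded there. \<open>torsion_free\<close> turns antisymmetry into vanishing on repeated
  arguments.\<close>

lemma alternating_maps_3I:
  fixes F :: "'a::plus list \<Rightarrow> 'c::ab_group_add"
  assumes torsion_free: "\<And>y::'c. y = - y \<Longrightarrow> y = 0"
    and sC: "\<And>r y. sC r (- y) = - sC r y"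
    and closed: "\<And>a b c. a \<in> L \<Longrightarrow> b \<in> L \<Longrightarrow> c \<in> L \<Longrightarrow> F [a, b, c] \<in> C"
    and outside: "\<And>xs. \<not> (length xs = 3 \<and> set xs \<subseteq> L) \<Longrightarrow> F xs = 0"
    and L: "\<And>a b. a \<in> L \<Longrightarrow> b \<in> L \<Longrightarrow> a + b \<in> L" "\<And>r a. r \<in> R \<Longrightarrow> a \<in> L \<Longrightarrow> sL r a \<in> L"
    and add: "\<And>a a' b c. a \<in> L \<Longrightarrow> a' \<in> L \<Longrightarrow> b \<in> L \<Longrightarrow> c \<in> L \<Longrightarrow>
      F [a + a', b, c] = F [a, b, c] + F [a', b, c]"
    and scale: "\<And>r a b c. r \<in> R \<Longrightarrow> a \<in> L \<Longrightarrow> b \<in> L \<Longrightarrow> c \<in> L \<Longrightarrow>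
      F [sL r a, b, c] = sC r (F [a, b, c])"
    and swap: "\<And>a b c. a \<in> L \<Longrightarrow> b \<in> L \<Longrightarrow> c \<in> L \<Longrightarrow> F [b, a, c] = - F [a, b, c]"
      "\<And>a b c. a \<in> L \<Longrightarrow> b \<in> L \<Longrightarrow> c \<in> L \<Longrightarrow> F [a, c, b] = - F [a, b, c]"
  shows "F \<in> alternating_maps R sL L sC C 3"
proof -
  have add2: "F [b, a + a', c] = F [b, a, c] + F [b, a', c]"
    if "a \<in> L" "a' \<in> L" "b \<in> L" "c \<in> L" for a a' b c
    using that add[of a a' b c] swap(1)[of "a + a'" b c] swap(1)[of a b c] swap(1)[of a' b c] L
    by simp
  have scale2: "F [b, sL r a, c] = sC r (F [b, a, c])"
    if "r \<in> R" "a \<in> L" "b \<in> L" "c \<in> L" for r a b c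
    using that scale[of r a b c] swap(1)[of "sL r a" b c] swap(1)[of a b c] L sC
    by simp
  have add3: "F [b, c, a + a'] = F [b, c, a] + F [b, c, a']"
    if "a \<in> L" "a' \<in> L" "b \<in> L" "c \<in> L" for a a' b c
    using that add2[of a a' b c] swap(2)[of b "a + a'" c] swap(2)[of b a c] swap(2)[of b a' c] L
    by simp
  have scale3: "F [b, c, sL r a] = sC r (F [b, c, a])"
    if "r \<in> R" "a \<in> L" "b \<in> L" "c \<in> L" for r a b c
    using that scale2[of r a b c] swap(2)[of b "sL r a" c] swap(2)[of b a c] L sC by simp
  have alt: "F [a, a, b] = 0" "F [b, a, a] = 0" "F [a, b, a] = 0" if "a \<in> L" "b \<in> L" for a b
  proof -
    show 1: "F [a, a, b] = 0" using torsion_free swap(1)[of a a b] that by simp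
    show "F [b, a, a] = 0" using torsion_free swap(2)[of b a a] that by simp
    show "F [a, b, a] = 0" using swap(2)[of a a b] that 1 by simp
  qed
  have list: "\<exists>a b c. xs = [a, b, c] \<and> a \<in> L \<and> b \<in> L \<and> c \<in> L"
    if "length xs = 3" "set xs \<subseteq> L" for xs
    using that by (auto simp: numeral_3_eq_3 length_Suc_conv)
  show ?thesis
    unfolding alternating_maps_def
  proof (intro CollectI conjI allI impI; (elim conjE)?)
    fix xs assume "length xs = 3" "set xs \<subseteq> L"
    then show "F xs \<in> C" using list closed by metis
  next
    fix xs i a b assume "length xs = 3" "set xs \<subseteq> L" "i < (3::nat)" "a \<in> L" "b \<in> L"
    moreover from this obtain x y z where "xs = [x, y, z]" "x \<in> L" "y \<in> L" "z \<in> L"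
      using list by metis
    moreover from \<open>i < 3\<close> have "i = 0 \<or> i = 1 \<or> i = 2" by auto
    ultimately show "F (xs[i := a + b]) = F (xs[i := a]) + F (xs[i := b])"
      by (auto simp: add add2 add3 numeral_2_eq_2)
  next
    fix xs i r a assume "length xs = 3" "set xs \<subseteq> L" "i < (3::nat)" "r \<in> R" "a \<in> L"
    moreover from this obtain x y z where "xs = [x, y, z]" "x \<in> L" "y \<in> L" "z \<in> L"
      using list by metis
    moreover from \<open>i < 3\<close> have "i = 0 \<or> i = 1 \<or> i = 2" by auto
    ultimately show "F (xs[i := sL r a]) = sC r (F (xs[i := a]))"
      by (auto simp: scale scale2 scale3 numeral_2_eq_2)
  next
    fix xs :: "'a list" and i j :: nat
    assume "length xs = 3" "set xs \<subseteq> L" "i < j" "j < 3" "xs ! i = xs ! j"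
    moreover from this obtain x y z where "xs = [x, y, z]" "x \<in> L" "y \<in> L" "z \<in> L"
      using list by metis
    moreover from \<open>i < j\<close> \<open>j < 3\<close> have "i = 0 \<and> j = 1 \<or> i = 0 \<and> j = 2 \<or> i = 1 \<and> j = 2" by auto
    ultimately show "F xs = 0" by (auto simp: alt numeral_2_eq_2)
  qed (rule outside, simp)
qed

lemma alternating_maps_plus:
  assumes F: "F \<in> alternating_maps R sL L sC C k" and G: "G \<in> alternating_maps R sL L sC C k"
    and C: "\<And>x y. x \<in> C \<Longrightarrow> y \<in> C \<Longrightarrow> x + y \<in> C"
    and sC: "\<And>r x y. sC r (x + y) = sC r x + sC r y"
  shows "F + G \<in> alternating_maps R sL L sC (C :: 'c::ab_group_add set) k"
  using F G unfolding alternating_maps_def by (simp add: C sC ac_simps)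

lemma alternating_maps_minus:
  assumes F: "F \<in> alternating_maps R sL L sC C k" and G: "G \<in> alternating_maps R sL L sC C k"
    and C: "\<And>x y. x \<in> C \<Longrightarrow> y \<in> C \<Longrightarrow> x - y \<in> C"
    and sC: "\<And>r x y. sC r (x - y) = sC r x - sC r y"
  shows "F - G \<in> alternating_maps R sL L sC (C :: 'c::ab_group_add set) k"
  using F G unfolding alternating_maps_def by (simp add: C sC algebra_simps)


section \<open>The Koszul formula and the Lie derivative in low degree\<close>

lemma omit_simps [simp]: "omit 0 (x # xs) = xs" "omit (Suc i) (x # xs) = x # omit i xs"
  by (simp_all add: omit_def)

lemma length_omit: "i < length xs \<Longrightarrow> length (omit i xs) = length xs - 1"
  by (simp add: omit_def)

lemma koszul_1: "w \<in> L \<Longrightarrow> koszul L \<eta> [w] x = w x (\<eta> [])"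
  by (simp add: koszul_def lessThan_Suc)

lemma koszul_2: "w \<in> L \<Longrightarrow> z \<in> L \<Longrightarrow>
    koszul L \<eta> [w, z] x = w x (\<eta> [z]) - z x (\<eta> [w]) - \<eta> [bracket w z] x"
  by (simp add: koszul_def lessThan_Suc)

lemma koszul_3: "y \<in> L \<Longrightarrow> w \<in> L \<Longrightarrow> z \<in> L \<Longrightarrow>
    koszul L \<eta> [y, w, z] x = y x (\<eta> [w, z]) - w x (\<eta> [y, z]) + z x (\<eta> [y, w])
      - \<eta> [bracket y w, z] x + \<eta> [bracket y z, w] x - \<eta> [bracket w z, y] x"
  by (simp add: koszul_def lessThan_Suc)

lemma koszul_4: "u \<in> L \<Longrightarrow> y \<in> L \<Longrightarrow> w \<in> L \<Longrightarrow> z \<in> L \<Longrightarrow>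
    koszul L \<eta> [u, y, w, z] x =
      u x (\<eta> [y, w, z]) - y x (\<eta> [u, w, z]) + w x (\<eta> [u, y, z]) - z x (\<eta> [u, y, w])
      - \<eta> [bracket u y, w, z] x + \<eta> [bracket u w, y, z] x - \<eta> [bracket u z, y, w] x
      - \<eta> [bracket y w, u, z] x + \<eta> [bracket y z, u, w] x - \<eta> [bracket w z, u, y] x"
  by (simp add: koszul_def lessThan_Suc)

text \<open>Both kinds of summands evaluate \<eta> on lists one entry shorter than
  \<open>ws\<close>, hence outside its degree. A field is then applied to the zero function, which
  explains the second hypothesis.\<close>

lemma koszul_outside:
  assumes "\<And>xs. \<not> (length xs = k \<and> set xs \<subseteq> L) \<Longrightarrow> \<eta> xs = 0"
    and "\<And>X x. X \<in> L \<Longrightarrow> X x 0 = 0" and "\<not> (length ws = Suc k \<and> set ws \<subseteq> L)"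
  shows "koszul L \<eta> ws = 0"
proof (cases "set ws \<subseteq> L")
  case True
  then have len: "length ws \<noteq> Suc k" using assms(3) by simp
  have "\<eta> (omit i ws) = 0" if "i < length ws" for i
    by (rule assms(1)) (use that len in \<open>auto simp: length_omit\<close>)
  moreover have "\<eta> (b # omit i (omit j ws)) = 0" if "j < length ws" "i < j" for i j b
    by (rule assms(1)) (use that len in \<open>auto simp: length_omit\<close>)
  moreover have zero: "(ws ! i) x 0 = 0" if "i < length ws" for i x
    by (rule assms(2)) (use that True nth_mem in blast)
  ultimately show ?thesis
    using True by (intro ext) (auto simp: koszul_def intro!: sum.neutral)
qed (simp add: koszul_def fun_eq_iff)

lemma lie_derivative_1: "w \<in> L \<Longrightarrow>
    lie_derivative L X \<eta> [w] x = X x (\<eta> [w]) - \<eta> [bracket X w] x"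
  by (simp add: lie_derivative_def)

lemma lie_derivative_2: "w \<in> L \<Longrightarrow> z \<in> L \<Longrightarrow>
    lie_derivative L X \<eta> [w, z] x = X x (\<eta> [w, z]) - \<eta> [bracket X w, z] x - \<eta> [w, bracket X z] x"
  by (simp add: lie_derivative_def lessThan_Suc)

lemma lie_derivative_3: "w \<in> L \<Longrightarrow> z \<in> L \<Longrightarrow> y \<in> L \<Longrightarrow>
    lie_derivative L X \<eta> [w, z, y] x = X x (\<eta> [w, z, y]) - \<eta> [bracket X w, z, y] x
      - \<eta> [w, bracket X z, y] x - \<eta> [w, z, bracket X y] x"
  by (simp add: lie_derivative_def lessThan_Suc)

lemma lie_derivative_outside:
  assumes "\<And>xs. \<not> (length xs = k \<and> set xs \<subseteq> L) \<Longrightarrow> \<eta> xs = 0"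
    and "\<And>x. X x 0 = 0" and "\<not> (length ws = k \<and> set ws \<subseteq> L)"
  shows "lie_derivative L X \<eta> ws = 0"
proof (cases "set ws \<subseteq> L")
  case True
  then have "\<eta> ws = 0" "\<And>i b. \<eta> (ws[i := b]) = 0" using assms(1,3) by simp_all
  then show ?thesis using assms(2) by (intro ext) (simp add: lie_derivative_def)
qed (simp add: lie_derivative_def fun_eq_iff)


section \<open>Horizontal lifts and curvature\<close>

locale ehresmann_submersion =
  fixes F :: "('m::{t2_space, second_countable_topology}, 'e::real_inner,
               'b::{t2_space, second_countable_topology}, 'f::real_inner) fibred"
    and Hor :: "'m distribution"
  assumes submersion: "surjective_submersion F"
    and connection: "ehresmann_connection F Hor"

sublocale ehresmann_submersion \<subseteq> total: smooth_atlas "total_atlas F"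
  using submersion by unfold_locales (simp add: surjective_submersion_def)

sublocale ehresmann_submersion \<subseteq> base: smooth_atlas "base_atlas F"
  using submersion by unfold_locales (simp add: surjective_submersion_def)

context ehresmann_submersion
begin

abbreviation "SM \<equiv> smooth_functions (total_atlas F)"
abbreviation "SB \<equiv> smooth_functions (base_atlas F)"
abbreviation "XM \<equiv> vector_fields (total_atlas F)"
abbreviation "XB \<equiv> vector_fields (base_atlas F)"
abbreviation "VF \<equiv> vertical_fields F"
abbreviation "h \<equiv> hlift F Hor"
abbreviation "curv \<equiv> curvature F Hor"
abbreviation "lie \<equiv> lie_derivative VF"

lemma pullback_smooth [simp]: "f \<in> SB \<Longrightarrow> f \<circ> proj F \<in> SM"
  using submersion smooth_functions_pullback unfolding surjective_submersion_def by blast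

lemma connection_at:
  shows Hor_tangent: "u \<in> Hor x \<Longrightarrow> u \<in> tangent_space (total_atlas F) x"
    and Hor_lincomb: "u \<in> Hor x \<Longrightarrow> w \<in> Hor x \<Longrightarrow> (\<lambda>f. a * u f + b * w f) \<in> Hor x"
    and vertical_Int_Hor: "vertical_space F x \<inter> Hor x = {0}"
    and vertical_plus_Hor: "u \<in> tangent_space (total_atlas F) x \<Longrightarrow>
      \<exists>w\<in>vertical_space F x. \<exists>e\<in>Hor x. u = w + e"
    and hlift_field: "v \<in> XB \<Longrightarrow> h v \<in> XM"
  using connection unfolding ehresmann_connection_def by blast+

text \<open>Existence: take any tangent preimage and discard its vertical part. Uniqueness: the
  difference of two candidates is both vertical and horizontal. This makes the \<open>THE\<close> in
  \<open>hlift\<close> meaningful.\<close>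

lemma hlift_ex1:
  assumes "v \<in> XB"
  shows "\<exists>!u. u \<in> Hor x \<and> tangent_map F u = v (proj F x)"
proof (rule ex_ex1I)
  have "v (proj F x) \<in> tangent_map F ` tangent_space (total_atlas F) x"
    using submersion assms unfolding surjective_submersion_def vector_fields_def by blast
  then obtain u where u: "u \<in> tangent_space (total_atlas F) x" "tangent_map F u = v (proj F x)"
    by auto
  obtain w e where we: "w \<in> vertical_space F x" "e \<in> Hor x" "u = w + e"
    using vertical_plus_Hor[OF u(1)] by blast
  have "tangent_map F u = tangent_map F w + tangent_map F e"
    unfolding we(3) by (auto simp: tangent_map_def fun_eq_iff)
  then have "tangent_map F e = v (proj F x)" using we(1) u(2) by (simp add: vertical_space_def)
  then show "\<exists>u. u \<in> Hor x \<and> tangent_map F u = v (proj F x)" using we(2) by blast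
next
  fix u w assume u: "u \<in> Hor x \<and> tangent_map F u = v (proj F x)"
    and w: "w \<in> Hor x \<and> tangent_map F w = v (proj F x)"
  let ?d = "\<lambda>f. 1 * u f + (-1) * w f"
  have d: "?d \<in> Hor x" using Hor_lincomb u w by blast
  have "tangent_map F ?d = tangent_map F u - tangent_map F w"
    by (auto simp: tangent_map_def fun_eq_iff)
  then have "?d \<in> vertical_space F x" using u w Hor_tangent[OF d] by (simp add: vertical_space_def)
  then have "?d = 0" using d vertical_Int_Hor by blast
  then show "u = w" by (simp add: fun_eq_iff)
qed

lemma
  assumes "v \<in> XB"
  shows hlift_Hor: "h v x \<in> Hor x" and tangent_map_hlift: "tangent_map F (h v x) = v (proj F x)"
  using theI'[OF hlift_ex1[OF assms, of x]] by (simp_all add: hlift_def)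

lemma hlift_eqI:
  assumes "v \<in> XB" "u \<in> Hor x" "tangent_map F u = v (proj F x)"
  shows "h v x = u"
  unfolding hlift_def by (rule the1_equality[OF hlift_ex1]) (use assms in auto)

lemma hlift_add: "u \<in> XB \<Longrightarrow> v \<in> XB \<Longrightarrow> h (u + v) = h u + h v"
proof
  fix x assume uv: "u \<in> XB" "v \<in> XB"
  show "h (u + v) x = (h u + h v) x"
  proof (rule hlift_eqI)
    show "(h u + h v) x \<in> Hor x"
      using Hor_lincomb[OF hlift_Hor[OF uv(1)] hlift_Hor[OF uv(2)], where a = 1 and b = 1]
      by (simp add: plus_fun_def)
    have "tangent_map F ((h u + h v) x) = tangent_map F (h u x) + tangent_map F (h v x)"
      by (auto simp: tangent_map_def fun_eq_iff)
    then show "tangent_map F ((h u + h v) x) = (u + v) (proj F x)"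
      by (simp add: tangent_map_hlift uv)
  qed (use uv base.vector_fields_add in auto)
qed

lemma hlift_scale: "f \<in> SB \<Longrightarrow> v \<in> XB \<Longrightarrow> h (scale_field f v) = scale_field (f \<circ> proj F) (h v)"
proof
  fix x assume fv: "f \<in> SB" "v \<in> XB"
  show "h (scale_field f v) x = scale_field (f \<circ> proj F) (h v) x"
  proof (rule hlift_eqI)
    show "scale_field (f \<circ> proj F) (h v) x \<in> Hor x"
      using Hor_lincomb[OF hlift_Hor[OF fv(2)] hlift_Hor[OF fv(2)], where a = "f (proj F x)" and b = 0]
      by (simp add: scale_field_def)
    have "tangent_map F (scale_field (f \<circ> proj F) (h v) x) =
        (\<lambda>g. f (proj F x) * tangent_map F (h v x) g)"
      by (auto simp: tangent_map_def fun_eq_iff scale_field_def)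
    then show "tangent_map F (scale_field (f \<circ> proj F) (h v) x) = scale_field f v (proj F x)"
      by (simp add: tangent_map_hlift fv scale_field_def)
  qed (use fv base.vector_fields_scale in auto)
qed

lemma hlift_uminus: "v \<in> XB \<Longrightarrow> h (- v) = - h v"
proof -
  assume v: "v \<in> XB"
  have neg: "scale_field (\<lambda>_. - 1) X = - X" for X :: "'x vfield"
    by (simp add: scale_field_def fun_eq_iff)
  show "h (- v) = - h v"
    using hlift_scale[OF smooth_functions_const v, of "-1"] by (simp add: neg comp_def)
qed

lemma hlift_diff: "u \<in> XB \<Longrightarrow> v \<in> XB \<Longrightarrow> h (u - v) = h u - h v"
  using hlift_add[of u "- v"] hlift_uminus[of v] base.vector_fields_uminus[of v] by simp

text \<open>\<open>h v\<close> and \<open>v\<close> are related by the projection; tested on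
  pulled-back functions, this is what makes brackets with lifts computable.\<close>

lemma hlift_pullback: "v \<in> XB \<Longrightarrow> f \<in> SB \<Longrightarrow> h v x (f \<circ> proj F) = v (proj F x) f"
  using fun_cong[OF tangent_map_hlift[of v x], of f] by (simp add: tangent_map_def)

lemma field_comp: "(\<lambda>y. v y f) \<circ> p = (\<lambda>x. v (p x) f)"
  by (simp add: comp_def)

text \<open>\<open>tangent_map\<close> records only the values on pulled-back functions, so a field
  is vertical when it annihilates them. Closure properties of \<open>VF\<close> are derived from
  this criterion.\<close>

lemma vertical_fields_iff: "X \<in> VF \<longleftrightarrow> X \<in> XM \<and> (\<forall>f\<in>SB. \<forall>x. X x (f \<circ> proj F) = 0)"
  unfolding vertical_fields_def vertical_space_def vector_fields_def tangent_map_def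
  by (auto simp: fun_eq_iff)

lemma vertical_field: "X \<in> VF \<Longrightarrow> X \<in> XM"
  and vertical_pullback: "X \<in> VF \<Longrightarrow> f \<in> SB \<Longrightarrow> X x (f \<circ> proj F) = 0"
  by (simp_all add: vertical_fields_iff)

lemma vertical_diff: "X \<in> VF \<Longrightarrow> Y \<in> VF \<Longrightarrow> X - Y \<in> VF"
  by (simp add: vertical_fields_iff total.vector_fields_diff)

lemma vertical_add: "X \<in> VF \<Longrightarrow> Y \<in> VF \<Longrightarrow> X + Y \<in> VF"
  by (simp add: vertical_fields_iff total.vector_fields_add)

lemma vertical_scale: "f \<in> SM \<Longrightarrow> X \<in> VF \<Longrightarrow> scale_field f X \<in> VF"
  using total.vector_fields_scale by (simp add: vertical_fields_iff scale_field_def)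

lemma vertical_bracket: "X \<in> VF \<Longrightarrow> Y \<in> VF \<Longrightarrow> bracket X Y \<in> VF"
  unfolding vertical_fields_iff
  by (intro conjI total.vector_fields_bracket)
    (simp_all add: bracket_def total.field_zero_fun[unfolded zero_fun_def])

section \<open>Brackets with horizontal lifts, curvature and the Bianchi identity\<close>

lemma bracket_hlift_pullback:
  assumes "u \<in> XB" "v \<in> XB" "f \<in> SB"
  shows "h u x (\<lambda>y. h v y (f \<circ> proj F)) = u (proj F x) (\<lambda>y. v y f)"
  using hlift_pullback[OF assms(1) base.field_smooth[OF assms(2,3)], of x] assms
  by (simp add: hlift_pullback field_comp)

text \<open>On a pullback of f, the field X annihilates both this pullback and the pullback of the
  derivative of f along v, so both halves of the bracket vanish.\<close>

lemma hlift_vertical_bracket: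
  assumes v: "v \<in> XB" and X: "X \<in> VF"
  shows "bracket (h v) X \<in> VF"
proof -
  have "bracket (h v) X x (f \<circ> proj F) = 0" if f: "f \<in> SB" for f x
    using vertical_pullback[OF X base.field_smooth[OF v f], of x] f
    by (simp add: bracket_def hlift_pullback[OF v f] vertical_pullback[OF X f] field_comp
        total.field_zero_fun[OF hlift_field[OF v], unfolded zero_fun_def])
  then show ?thesis
    using v X by (simp add: vertical_fields_iff total.vector_fields_bracket hlift_field)
qed

text \<open>The bracket of two lifts is related by the projection to the bracket below, as is the
  lift of that bracket; their difference annihilates pullbacks.\<close>

lemma curvature_vertical:
  assumes "u \<in> XB" "v \<in> XB"
  shows "curv u v \<in> VF"
proof -
  note uv = base.vector_fields_bracket[OF assms]
  have "curv u v x (f \<circ> proj F) = 0" if f: "f \<in> SB" for f x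
    using hlift_pullback[OF uv f, of x]
    by (simp add: curvature_def bracket_def bracket_hlift_pullback assms f)
  then show ?thesis
    unfolding curvature_def
    using assms uv by (simp add: vertical_fields_iff curvature_def total.vector_fields_diff
        total.vector_fields_bracket hlift_field)
qed

lemma bracket_hlift: "bracket (h u) (h v) = h (bracket u v) + curv u v"
  by (simp add: curvature_def)

lemma curvature_swap: "u \<in> XB \<Longrightarrow> v \<in> XB \<Longrightarrow> curv v u = - curv u v"
  using total.bracket_swap[of "h v" "h u"] base.bracket_swap[of v u]
  by (simp add: curvature_def hlift_uminus base.vector_fields_bracket)

lemma curvature_add_left:
  "u \<in> XB \<Longrightarrow> v \<in> XB \<Longrightarrow> w \<in> XB \<Longrightarrow> curv (u + v) w = curv u w + curv v w"
  by (simp add: curvature_def hlift_add base.bracket_add_left total.bracket_add_left hlift_field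
      base.vector_fields_bracket)

lemma curvature_scale_left:
  assumes "f \<in> SB" "u \<in> XB" "v \<in> XB"
  shows "curv (scale_field f u) v = scale_field (f \<circ> proj F) (curv u v)"
proof -
  \<comment> \<open>The derivative term of \<open>bracket (h (scale_field f u)) (h v)\<close> is
    itself the lift of the derivative term downstairs, so the two cancel in the curvature.\<close>
  have "scale_field (\<lambda>x. h v x (f \<circ> proj F)) (h u) = h (scale_field (\<lambda>x. v x f) u)"
    using assms by (simp add: hlift_pullback hlift_scale base.field_smooth field_comp)
  then show ?thesis
    using assms by (simp add: curvature_def hlift_scale hlift_diff base.bracket_scale_left
        total.bracket_scale_left hlift_field base.vector_fields_closed base.field_smooth)
      (simp add: scale_field_def fun_eq_iff algebra_simps)
qed

text \<open>With the curvature expanded, the triple brackets of lifts cancel by Jacobi on the total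
  space, the lifts of triple brackets by Jacobi on the base, and the mixed brackets in
  pairs.\<close>

lemma bianchi:
  assumes "a \<in> XB" "b \<in> XB" "c \<in> XB"
  shows "bracket (h a) (curv b c) - bracket (h b) (curv a c) + bracket (h c) (curv a b)
    - curv (bracket a b) c + curv (bracket a c) b - curv (bracket b c) a = 0"
proof -
  note cl = assms base.vector_fields_closed total.vector_fields_closed hlift_field
  have b: "h (bracket (bracket a b) c) = h (bracket a (bracket b c)) - h (bracket b (bracket a c))"
    using base.bracket_jacobi[OF assms] by (simp add: hlift_add cl)
  have s: "bracket (bracket a c) b = - bracket b (bracket a c)"
    "bracket (bracket b c) a = - bracket a (bracket b c)"
    by (rule base.bracket_swap)+
  have t: "bracket (h (bracket a c)) (h b) = - bracket (h b) (h (bracket a c))"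
    "bracket (h (bracket b c)) (h a) = - bracket (h a) (h (bracket b c))"
    "bracket (h (bracket a b)) (h c) = - bracket (h c) (h (bracket a b))"
    by (rule total.bracket_swap)+
  have j: "bracket (h c) (bracket (h a) (h b)) =
      bracket (h b) (bracket (h a) (h c)) - bracket (h a) (bracket (h b) (h c))"
    using total.bracket_jacobi[of "h a" "h b" "h c"] total.bracket_swap[of "h c" "bracket (h a) (h b)"] cl
    by (simp add: algebra_simps)
  show ?thesis
    by (simp add: curvature_def total.bracket_diff_right cl s t hlift_uminus b j)
qed


section \<open>Cartan calculus on vertical forms\<close>

text \<open>Outside this set the slots \<open>bracket X w\<close> in \<open>lie X\<close> could
  leave \<open>VF\<close>, where vertical forms are 0 by convention and \<open>lie\<close> is no
  longer the Lie derivative. Horizontal lifts enter the commutation rules for \<open>lie\<close>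
  only as members of this set.\<close>

definition normaliser :: "'m vfield set" where
  "normaliser = {X \<in> XM. \<forall>w\<in>VF. bracket X w \<in> VF}"

lemma normaliserD: "X \<in> normaliser \<Longrightarrow> X \<in> XM" "X \<in> normaliser \<Longrightarrow> w \<in> VF \<Longrightarrow> bracket X w \<in> VF"
  by (simp_all add: normaliser_def)

lemma normaliser_hlift: "v \<in> XB \<Longrightarrow> h v \<in> normaliser"
  by (simp add: normaliser_def hlift_field hlift_vertical_bracket)

lemma vertical_forms_smooth:
  "\<eta> \<in> vertical_forms F q \<Longrightarrow> length ws = q \<Longrightarrow> set ws \<subseteq> VF \<Longrightarrow> \<eta> ws \<in> SM"
  unfolding vertical_forms_def by (rule alternating_maps_closed)

lemma vertical_forms_outside:
  "\<eta> \<in> vertical_forms F q \<Longrightarrow> \<not> (length ws = q \<and> set ws \<subseteq> VF) \<Longrightarrow> \<eta> ws = 0"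
  unfolding vertical_forms_def by (rule alternating_maps_outside)

lemma vertical_forms_add:
  "\<eta> \<in> vertical_forms F q \<Longrightarrow> \<theta> \<in> vertical_forms F q \<Longrightarrow> \<eta> + \<theta> \<in> vertical_forms F q"
  unfolding vertical_forms_def
  by (rule alternating_maps_plus) (simp_all add: total.smooth_add algebra_simps)

lemma vertical_forms_diff:
  "\<eta> \<in> vertical_forms F q \<Longrightarrow> \<theta> \<in> vertical_forms F q \<Longrightarrow> \<eta> - \<theta> \<in> vertical_forms F q"
  unfolding vertical_forms_def
  by (rule alternating_maps_minus) (auto simp: total.smooth_diff fun_eq_iff algebra_simps)

lemma vertical_forms_scale:
  "f \<in> SM \<Longrightarrow> \<eta> \<in> vertical_forms F q \<Longrightarrow> (\<lambda>ws. f * \<eta> ws) \<in> vertical_forms F q"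
  unfolding vertical_forms_def alternating_maps_def
  by (auto simp: total.smooth_mult algebra_simps)

lemma vertical_forms_uminus:
  assumes "\<eta> \<in> vertical_forms F q"
  shows "- \<eta> \<in> vertical_forms F q"
  using vertical_forms_diff[OF vertical_forms_diff[OF assms assms] assms] by simp

lemmas vertical_forms_closed =
  vertical_forms_add vertical_forms_diff vertical_forms_uminus vertical_forms_scale

lemma vertical_form1_eqI:
  assumes "\<eta> \<in> vertical_forms F 1" "\<theta> \<in> vertical_forms F 1"
    and "\<And>w x. w \<in> VF \<Longrightarrow> \<eta> [w] x = \<theta> [w] x"
  shows "\<eta> = \<theta>"
proof
  fix ws
  show "\<eta> ws = \<theta> ws"
  proof (cases "length ws = 1 \<and> set ws \<subseteq> VF")
    case True
    then obtain w where "ws = [w]" "w \<in> VF" by (auto simp: length_Suc_conv)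
    then show ?thesis using assms(3) by auto
  qed (use assms(1,2) vertical_forms_outside in auto)
qed

text \<open>Linearity over functions: the derivative of f along X from the Leibniz rule cancels the
  one produced by \<open>bracket_scale_right\<close>.\<close>

lemma lie_vertical_form1:
  assumes X: "X \<in> normaliser" and \<eta>: "\<eta> \<in> vertical_forms F 1"
  shows "lie X \<eta> \<in> vertical_forms F 1"
proof -
  note XM = normaliserD(1)[OF X]
  note r = alternating_maps_1[OF vertical_diff \<eta>[unfolded vertical_forms_def]]
  have scale: "\<eta> [scale_field f w] = f * \<eta> [w]" if "w \<in> VF" "f \<in> SM" for w f
    using alternating_maps_scale[OF vertical_diff \<eta>[unfolded vertical_forms_def], of "[]" w "[]" f]
      that by simp
  have s: "\<eta> [w] \<in> SM" if "w \<in> VF" for w using vertical_forms_smooth[OF \<eta>, of "[w]"] that by simp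
  note b = normaliserD(2)[OF X] total.bracket_add_right total.bracket_scale_right vertical_field XM
    vertical_add vertical_scale total.field_smooth
  show ?thesis
    unfolding vertical_forms_def
  proof (rule alternating_maps_1I)
    fix w assume w: "w \<in> VF"
    have "lie X \<eta> [w] = (\<lambda>x. X x (\<eta> [w])) - \<eta> [bracket X w]"
      by (simp add: lie_derivative_1 w fun_eq_iff)
    then show "lie X \<eta> [w] \<in> SM"
      by (simp add: total.smooth_diff total.field_smooth XM s w normaliserD(2)[OF X])
  next
    fix ws assume "\<not> (length ws = 1 \<and> set ws \<subseteq> VF)"
    then show "lie X \<eta> ws = 0"
      by (intro lie_derivative_outside[of 1] vertical_forms_outside[OF \<eta>] total.field_zero_fun[OF XM])
  next
    fix w z assume "w \<in> VF" "z \<in> VF"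
    then show "lie X \<eta> [w + z] = lie X \<eta> [w] + lie X \<eta> [z]"
      by (simp add: fun_eq_iff lie_derivative_1 b r s total.field_rules[OF XM])
  next
    fix f w assume "f \<in> SM" "w \<in> VF"
    then show "lie X \<eta> [scale_field f w] = f * lie X \<eta> [w]"
      by (simp add: fun_eq_iff lie_derivative_1 b r s scale total.field_rules[OF XM] algebra_simps)
  qed
qed

lemma interior_product_vertical_form1:
  assumes X: "X \<in> VF" and \<eta>: "\<eta> \<in> vertical_forms F 2"
  shows "interior_product X \<eta> \<in> vertical_forms F 1"
  unfolding vertical_forms_def
proof (rule alternating_maps_1I)
  note alt = vertical_diff \<eta>[unfolded vertical_forms_def]
  fix w z f assume w: "w \<in> VF"
  show "interior_product X \<eta> [w] \<in> SM"
    unfolding interior_product_def by (rule vertical_forms_smooth[OF \<eta>]) (use X w in auto)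
  show "interior_product X \<eta> [w + z] = interior_product X \<eta> [w] + interior_product X \<eta> [z]" if "z \<in> VF"
    using alternating_maps_2[OF alt w that X] by (simp add: interior_product_def)
  show "interior_product X \<eta> [scale_field f w] = f * interior_product X \<eta> [w]" if "f \<in> SM"
    using alternating_maps_scale[OF alt, of "[X]" w "[]" f] X w that by (simp add: interior_product_def)
next
  fix ws assume "\<not> (length ws = 1 \<and> set ws \<subseteq> VF)"
  then show "interior_product X \<eta> ws = 0"
    unfolding interior_product_def by (intro vertical_forms_outside[OF \<eta>]) auto
qed

text \<open>Off its domain a form is the zero function, which is smooth, so the condition on the
  arguments disappears.\<close>

lemma vertical_forms_smooth': "\<eta> \<in> vertical_forms F q \<Longrightarrow> \<eta> ws \<in> SM"
  using vertical_forms_smooth vertical_forms_outside total.smooth_zero by metis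

text \<open>A field respects differences of smooth functions only, which is why both arguments have
  to be forms.\<close>

lemma vertical_d_diff:
  assumes "\<eta> \<in> vertical_forms F q" "\<theta> \<in> vertical_forms F q"
  shows "vertical_d F (\<eta> - \<theta>) = vertical_d F \<eta> - vertical_d F \<theta>"
proof (intro ext)
  fix ws x
  show "vertical_d F (\<eta> - \<theta>) ws x = (vertical_d F \<eta> - vertical_d F \<theta>) ws x"
  proof (cases "set ws \<subseteq> VF")
    case True
    then have "(ws ! i) x (\<eta> us - \<theta> us) = (ws ! i) x (\<eta> us) - (ws ! i) x (\<theta> us)"
      if "i < length ws" for i us
      by (intro total.field_diff_fun vertical_field vertical_forms_smooth'[OF assms(1)]
          vertical_forms_smooth'[OF assms(2)]) (use that nth_mem in blast)
    then have "(\<Sum>i<length ws. (-1) ^ i * (ws ! i) x ((\<eta> - \<theta>) (omit i ws))) =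
        (\<Sum>i<length ws. (-1) ^ i * (ws ! i) x (\<eta> (omit i ws))) -
        (\<Sum>i<length ws. (-1) ^ i * (ws ! i) x (\<theta> (omit i ws)))"
      by (simp add: sum_subtractf right_diff_distrib)
    then show ?thesis
      using True by (simp add: vertical_d_def koszul_def sum_subtractf right_diff_distrib)
  qed (simp add: vertical_d_def koszul_def)
qed

lemma vertical_d_add:
  assumes "\<eta> \<in> vertical_forms F q" "\<theta> \<in> vertical_forms F q"
  shows "vertical_d F (\<eta> + \<theta>) = vertical_d F \<eta> + vertical_d F \<theta>"
  using vertical_d_diff[OF vertical_forms_add[OF assms] assms(2)] by simp

lemma vertical_d_outside:
  assumes "\<eta> \<in> vertical_forms F q" "\<not> (length ws = Suc q \<and> set ws \<subseteq> VF)"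
  shows "vertical_d F \<eta> ws = 0"
  unfolding vertical_d_def
  by (rule koszul_outside[OF vertical_forms_outside[OF assms(1)] _ assms(2)])
    (simp_all add: total.field_zero_fun vertical_field)

text \<open>Expanding both sides, second derivatives match through \<open>bracket X w\<close> and
  \<open>bracket X z\<close> acting on functions, and nested brackets inside \<eta> match by
  Jacobi.\<close>

lemma vertical_d_lie:
  assumes X: "X \<in> normaliser" and \<eta>: "\<eta> \<in> vertical_forms F 1" and w: "w \<in> VF" and z: "z \<in> VF"
  shows "vertical_d F (lie X \<eta>) [w, z] x = lie X (vertical_d F \<eta>) [w, z] x"
proof -
  note XM = normaliserD(1)[OF X]
  have s: "\<eta> [u] \<in> SM" if "u \<in> VF" for u
    using vertical_forms_smooth[OF \<eta>, of "[u]"] that by simp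
  note r = alternating_maps_1[OF vertical_diff \<eta>[unfolded vertical_forms_def]]
  have lie: "lie X \<eta> [u] = (\<lambda>x. X x (\<eta> [u]) - \<eta> [bracket X u] x)" if "u \<in> VF" for u
    by (simp add: lie_derivative_1 that fun_eq_iff)
  have vd: "vertical_d F \<eta> [u, v] = (\<lambda>x. u x (\<eta> [v]) - v x (\<eta> [u]) - \<eta> [bracket u v] x)"
    if "u \<in> VF" "v \<in> VF" for u v
    by (simp add: vertical_d_def koszul_2 that fun_eq_iff)
  note b = normaliserD(2)[OF X] vertical_bracket
  have "vertical_d F (lie X \<eta>) [w, z] x = w x (lie X \<eta> [z]) - z x (lie X \<eta> [w]) - lie X \<eta> [bracket w z] x"
    by (simp add: vertical_d_def koszul_2 w z)
  moreover have "\<eta> [bracket X (bracket w z)] = \<eta> [bracket (bracket X w) z] + \<eta> [bracket w (bracket X z)]"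
    using total.bracket_jacobi[OF XM vertical_field[OF w] vertical_field[OF z]] b w z r by simp
  ultimately show ?thesis
    using w z by (simp add: lie_derivative_2 lie vd b s total.field_rules[OF XM]
        total.field_rules[OF vertical_field[OF w]] total.field_rules[OF vertical_field[OF z]]
        total.field_smooth total.smooth_algebra XM vertical_field)
      (simp add: bracket_def)
qed

text \<open>Cartan's formula for the Lie derivative along X as \<open>d i + i d\<close>; the
  hypothesis \<open>closed\<close> removes the second summand.\<close>

lemma vertical_d_interior_product:
  assumes X: "X \<in> VF" and w: "w \<in> VF" and z: "z \<in> VF" and \<eta>: "\<eta> \<in> vertical_forms F 2"
    and closed: "vertical_d F \<eta> [X, w, z] x = 0"
  shows "vertical_d F (interior_product X \<eta>) [w, z] x = lie X \<eta> [w, z] x"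
proof -
  have swap: "\<eta> [u, v] = - \<eta> [v, u]" if "u \<in> VF" "v \<in> VF" for u v
    using alternating_maps_swap_2[OF vertical_diff \<eta>[unfolded vertical_forms_def]] that by blast
  show ?thesis
    using closed swap[of w "bracket X z"] swap[of "bracket w z" X] assms
    by (simp add: vertical_d_def koszul_2 koszul_3 lie_derivative_2 interior_product_def
        vertical_bracket)
qed

text \<open>Mixed terms, with one bracket inside \<eta> and one outer derivative, are symmetric in X
  and Y; Jacobi handles the double brackets.\<close>

lemma lie_commutator:
  assumes X: "X \<in> normaliser" and Y: "Y \<in> normaliser" and \<eta>: "\<eta> \<in> vertical_forms F 2"
    and w: "w \<in> VF" and z: "z \<in> VF"
  shows "lie X (lie Y \<eta>) [w, z] x - lie Y (lie X \<eta>) [w, z] x = lie (bracket X Y) \<eta> [w, z] x"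
proof -
  note XM = normaliserD(1)[OF X] and YM = normaliserD(1)[OF Y]
  note b = normaliserD(2)[OF X] normaliserD(2)[OF Y] vertical_field
  have s: "\<eta> [u, v] \<in> SM" if "u \<in> VF" "v \<in> VF" for u v
    using vertical_forms_smooth[OF \<eta>, of "[u, v]"] that by simp
  note r = alternating_maps_2[OF vertical_diff \<eta>[unfolded vertical_forms_def]]
  have lie: "lie Z \<eta> [u, v] = (\<lambda>x. Z x (\<eta> [u, v]) - \<eta> [bracket Z u, v] x - \<eta> [u, bracket Z v] x)"
    if "u \<in> VF" "v \<in> VF" for u v Z
    by (simp add: lie_derivative_2 that fun_eq_iff)
  have j: "bracket (bracket X Y) u = bracket X (bracket Y u) - bracket Y (bracket X u)"
    if "u \<in> VF" for u
    using total.bracket_jacobi[OF XM YM vertical_field[OF that]] by simp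
  show ?thesis
    using w z by (simp add: lie_derivative_2 lie j r b s total.field_rules[OF XM]
        total.field_rules[OF YM] total.field_smooth total.smooth_algebra XM YM)
      (simp add: bracket_def)
qed

text \<open>The commutator of the Lie derivative along X with contraction by Y is contraction with
  \<open>bracket X Y\<close>; the last hypothesis kills the term in which \<eta> itself is
  differentiated.\<close>

lemma lie_interior_product:
  assumes "w \<in> VF" "z \<in> VF" "Y \<in> VF" "lie X \<eta> [Y, w, z] x = 0"
  shows "lie X (interior_product Y \<eta>) [w, z] x = \<eta> [bracket X Y, w, z] x"
  using assms by (simp add: lie_derivative_2 lie_derivative_3 interior_product_def)


section \<open>The bigraded differentials in low degree\<close>

lemma partial_H_1: "a \<in> XB \<Longrightarrow> partial_H F Hor \<Theta> [a] ws x = lie (h a) (\<Theta> []) ws x"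
  by (simp add: partial_H_def lessThan_Suc)

lemma partial_H_2: "a \<in> XB \<Longrightarrow> b \<in> XB \<Longrightarrow> partial_H F Hor \<Theta> [a, b] ws x =
    lie (h a) (\<Theta> [b]) ws x - lie (h b) (\<Theta> [a]) ws x - \<Theta> [bracket a b] ws x"
  by (simp add: partial_H_def lessThan_Suc)

text \<open>An equation of forms and not of values, so that \<open>vertical_d\<close> can be
  distributed over the six terms.\<close>

lemma partial_H_3: "a \<in> XB \<Longrightarrow> b \<in> XB \<Longrightarrow> c \<in> XB \<Longrightarrow> partial_H F Hor \<Theta> [a, b, c] =
    lie (h a) (\<Theta> [b, c]) - lie (h b) (\<Theta> [a, c]) + lie (h c) (\<Theta> [a, b])
    - \<Theta> [bracket a b, c] + \<Theta> [bracket a c, b] - \<Theta> [bracket b c, a]"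
  by (simp add: partial_H_def lessThan_Suc fun_eq_iff)

lemma partial_C_2: "a \<in> XB \<Longrightarrow> b \<in> XB \<Longrightarrow> partial_C F Hor 0 \<Theta> [a, b] ws x =
    - \<Theta> [] (curv a b # ws) x"
  by (simp add: partial_C_def lessThan_Suc interior_product_def)

text \<open>The pairs carry signs -, +, -, and the factor \<open>(-1) ^ p\<close> with p = 1
  reverses them.\<close>

lemma partial_C_3: "a \<in> XB \<Longrightarrow> b \<in> XB \<Longrightarrow> c \<in> XB \<Longrightarrow> partial_C F Hor 1 \<Theta> [a, b, c] =
    interior_product (curv a b) (\<Theta> [c]) - interior_product (curv a c) (\<Theta> [b])
    + interior_product (curv b c) (\<Theta> [a])"
  by (simp add: partial_C_def lessThan_Suc fun_eq_iff)

lemma biforms_vertical: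
  "\<Theta> \<in> biforms F p q \<Longrightarrow> length vs = p \<Longrightarrow> set vs \<subseteq> XB \<Longrightarrow> \<Theta> vs \<in> vertical_forms F q"
  unfolding biforms_def by (rule alternating_maps_closed)

lemma biforms_outside:
  "\<Theta> \<in> biforms F p q \<Longrightarrow> \<not> (length vs = p \<and> set vs \<subseteq> XB) \<Longrightarrow> \<Theta> vs = 0"
  unfolding biforms_def by (rule alternating_maps_outside)

lemma biforms_add:
  "\<Theta> \<in> biforms F p q \<Longrightarrow> \<Psi> \<in> biforms F p q \<Longrightarrow> \<Theta> + \<Psi> \<in> biforms F p q"
  unfolding biforms_def
  by (rule alternating_maps_plus) (simp_all add: vertical_forms_add fun_eq_iff algebra_simps)

lemma biforms_diff:
  "\<Theta> \<in> biforms F p q \<Longrightarrow> \<Psi> \<in> biforms F p q \<Longrightarrow> \<Theta> - \<Psi> \<in> biforms F p q"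
  unfolding biforms_def
  by (rule alternating_maps_minus) (simp_all add: vertical_forms_diff fun_eq_iff algebra_simps)

lemma biforms_uminus: "\<Theta> \<in> biforms F p q \<Longrightarrow> - \<Theta> \<in> biforms F p q"
  using biforms_diff[of "\<Theta> - \<Theta>" p q \<Theta>] biforms_diff[of \<Theta> p q \<Theta>] by simp

text \<open>The values are vertical 1-forms, so the identities between them may be tested on one
  vertical field at one point.\<close>

lemma biforms_3_1I:
  assumes closed: "\<And>a b c. a \<in> XB \<Longrightarrow> b \<in> XB \<Longrightarrow> c \<in> XB \<Longrightarrow> \<Theta> [a, b, c] \<in> vertical_forms F 1"
    and outside: "\<And>vs. \<not> (length vs = 3 \<and> set vs \<subseteq> XB) \<Longrightarrow> \<Theta> vs = 0"
    and add: "\<And>a a' b c w x. a \<in> XB \<Longrightarrow> a' \<in> XB \<Longrightarrow> b \<in> XB \<Longrightarrow> c \<in> XB \<Longrightarrow> w \<in> VF \<Longrightarrow>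
      \<Theta> [a + a', b, c] [w] x = \<Theta> [a, b, c] [w] x + \<Theta> [a', b, c] [w] x"
    and scale: "\<And>f a b c w x. f \<in> SB \<Longrightarrow> a \<in> XB \<Longrightarrow> b \<in> XB \<Longrightarrow> c \<in> XB \<Longrightarrow> w \<in> VF \<Longrightarrow>
      \<Theta> [scale_field f a, b, c] [w] x = f (proj F x) * \<Theta> [a, b, c] [w] x"
    and swap: "\<And>a b c w x. a \<in> XB \<Longrightarrow> b \<in> XB \<Longrightarrow> c \<in> XB \<Longrightarrow> w \<in> VF \<Longrightarrow>
      \<Theta> [b, a, c] [w] x = - \<Theta> [a, b, c] [w] x"
      "\<And>a b c w x. a \<in> XB \<Longrightarrow> b \<in> XB \<Longrightarrow> c \<in> XB \<Longrightarrow> w \<in> VF \<Longrightarrow>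
      \<Theta> [a, c, b] [w] x = - \<Theta> [a, b, c] [w] x"
  shows "\<Theta> \<in> biforms F 3 1"
  unfolding biforms_def
proof (rule alternating_maps_3I)
  \<comment> \<open>Forms take real values, so there is no 2-torsion.\<close>
  show "y = 0" if "y = - y" for y :: "'m form"
  proof (intro ext)
    show "y ws x = 0 ws x" for ws x using fun_cong[OF fun_cong[OF that], of ws x] by simp
  qed
  note vf = closed vertical_forms_closed base.vector_fields_closed
  fix a b c assume a: "a \<in> XB" "b \<in> XB" "c \<in> XB"
  show "\<Theta> [a + a', b, c] = \<Theta> [a, b, c] + \<Theta> [a', b, c]" if "a' \<in> XB" for a'
    by (rule vertical_form1_eqI) (simp_all add: vf add a that del: One_nat_def)
  show "\<Theta> [scale_field f a, b, c] = (\<lambda>ws. (f \<circ> proj F) * \<Theta> [a, b, c] ws)" if "f \<in> SB" for f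
    by (rule vertical_form1_eqI) (simp_all add: vf scale a that del: One_nat_def)
  show "\<Theta> [b, a, c] = - \<Theta> [a, b, c]" "\<Theta> [a, c, b] = - \<Theta> [a, b, c]"
    by (rule vertical_form1_eqI; simp add: vf swap(1)[of a b c] swap(2)[of a b c] a del: One_nat_def)+
qed (simp_all add: closed outside base.vector_fields_closed fun_eq_iff del: One_nat_def)

text \<open>The delicate point is scaling by a function f on the base: the derivatives of f along
  \<open>h b\<close> and \<open>h c\<close> cancel against those from
  \<open>bracket (scale_field f a) b\<close> and \<open>bracket (scale_field f a) c\<close>.\<close>

lemma partial_H_biform:
  assumes \<Theta>: "\<Theta> \<in> biforms F 2 1"
  shows "partial_H F Hor \<Theta> \<in> biforms F 3 1"
proof (rule biforms_3_1I)
  note cl = base.vector_fields_closed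
  note r = alternating_maps_2[OF base.vector_fields_diff \<Theta>[unfolded biforms_def]]
  have scale: "\<Theta> [scale_field f u, v] = (\<lambda>ws. (f \<circ> proj F) * \<Theta> [u, v] ws)"
    "\<Theta> [v, scale_field f u] = (\<lambda>ws. (f \<circ> proj F) * \<Theta> [v, u] ws)"
    if "f \<in> SB" "u \<in> XB" "v \<in> XB" for f u v
    using alternating_maps_scale[OF base.vector_fields_diff \<Theta>[unfolded biforms_def], of "[]" u "[v]" f]
      alternating_maps_scale[OF base.vector_fields_diff \<Theta>[unfolded biforms_def], of "[v]" u "[]" f]
      that by simp_all
  have swap: "\<Theta> [u, v] = - \<Theta> [v, u]" if "u \<in> XB" "v \<in> XB" for u v
    using alternating_maps_swap_2[OF base.vector_fields_diff \<Theta>[unfolded biforms_def]] that by blast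
  have vf: "\<Theta> [u, v] \<in> vertical_forms F 1" if "u \<in> XB" "v \<in> XB" for u v
    using biforms_vertical[OF \<Theta>, of "[u, v]"] that by simp
  have s: "\<Theta> [u, v] [w] \<in> SM" if "u \<in> XB" "v \<in> XB" "w \<in> VF" for u v w
    using vertical_forms_smooth[OF vf, of u v "[w]"] that by simp
  have vr: "\<Theta> [u, v] [w + z] = \<Theta> [u, v] [w] + \<Theta> [u, v] [z]"
    if "u \<in> XB" "v \<in> XB" "w \<in> VF" "z \<in> VF" for u v w z
    using alternating_maps_1[OF vertical_diff vf[unfolded vertical_forms_def]] that by simp
  have vs: "\<Theta> [u, v] [scale_field f w] = f * \<Theta> [u, v] [w]"
    if "u \<in> XB" "v \<in> XB" "w \<in> VF" "f \<in> SM" for u v w f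
    using alternating_maps_scale[OF vertical_diff vf[unfolded vertical_forms_def], of u v "[]" w "[]" f]
      that by simp
  {
    fix a b c assume "a \<in> XB" "b \<in> XB" "c \<in> XB"
    then show "partial_H F Hor \<Theta> [a, b, c] \<in> vertical_forms F 1"
      by (simp add: partial_H_3 vertical_forms_closed lie_vertical_form1 normaliser_hlift vf cl
          del: One_nat_def)
  next
    fix vs assume vs: "\<not> (length vs = 3 \<and> set vs \<subseteq> XB)"
    show "partial_H F Hor \<Theta> vs = 0"
    proof (cases "set vs \<subseteq> XB")
      case True
      then have len: "length vs \<noteq> 3" using vs by simp
      have 1: "\<Theta> (omit i vs) = 0" if "i < length vs" for i
        by (rule biforms_outside[OF \<Theta>]) (use that len in \<open>auto simp: length_omit\<close>)
      have 2: "\<Theta> (u # omit i (omit j vs)) = 0" if "j < length vs" "i < j" for i j u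
        by (rule biforms_outside[OF \<Theta>]) (use that len in \<open>auto simp: length_omit\<close>)
      have "h (vs ! i) x 0 = 0" if "i < length vs" for i x
        by (rule total.field_zero_fun[OF hlift_field]) (use that True nth_mem in blast)
      then have 3: "lie (h (vs ! i)) 0 = 0" if "i < length vs" for i
        using that by (simp add: lie_derivative_def fun_eq_iff)
      show ?thesis by (intro ext) (auto simp: partial_H_def 1 2 3 intro!: sum.neutral)
    qed (simp add: partial_H_def fun_eq_iff)
  next
    fix a a' b c w x assume "a \<in> XB" "a' \<in> XB" "b \<in> XB" "c \<in> XB" "w \<in> VF"
    then show "partial_H F Hor \<Theta> [a + a', b, c] [w] x =
        partial_H F Hor \<Theta> [a, b, c] [w] x + partial_H F Hor \<Theta> [a', b, c] [w] x"
      by (simp add: partial_H_3 lie_derivative_1 hlift_add base.bracket_add_left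
          total.bracket_add_left cl r vr s hlift_field vertical_field hlift_vertical_bracket
          total.field_rules[OF hlift_field])
  next
    fix f a b c w x assume f: "f \<in> SB" and a: "a \<in> XB" "b \<in> XB" "c \<in> XB" and w: "w \<in> VF"
    have 0: "scale_field (\<lambda>x. 0) X = 0" for X :: "'m vfield"
      by (simp add: scale_field_def fun_eq_iff)
    \<comment> \<open>Being vertical, w annihilates the pullback of f, so no multiple of
      \<open>h a\<close> appears and the bracket is vertical again.\<close>
    have br: "bracket (h (scale_field f a)) w = scale_field (f \<circ> proj F) (bracket (h a) w)"
      using f a w by (simp add: hlift_scale total.bracket_scale_left hlift_field vertical_field
          vertical_pullback[OF w] 0)
    have diff: "\<Theta> [u - u', v] = \<Theta> [u, v] - \<Theta> [u', v]" if "u \<in> XB" "u' \<in> XB" "v \<in> XB" for u u' v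
      using r(2) that by simp
    have hs: "h (scale_field f a) x g = f (proj F x) * h a x g" for g
      by (subst hlift_scale[OF f a(1)]) (simp add: scale_field_def)
    have der: "h v x ((f \<circ> proj F) * \<Theta> [a, u] [w]) =
        f (proj F x) * h v x (\<Theta> [a, u] [w]) + v (proj F x) f * \<Theta> [a, u] [w] x"
      if "u \<in> XB" "v \<in> XB" for u v
      using f a w that total.field_mult_fun[OF hlift_field[OF that(2)] pullback_smooth[OF f] s, of a u w x]
      by (simp add: hlift_pullback)
    have fs: "(\<lambda>y. v y f) \<in> SB" if "v \<in> XB" for v
      using base.field_smooth[OF that f] .
    \<comment> \<open>The last summand is the counterpart of the last summand in \<open>der\<close>;
      the signs in \<open>partial_H\<close> make them cancel.\<close>
    have brk: "\<Theta> [bracket (scale_field f a) v, u] [w] x =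
        f (proj F x) * \<Theta> [bracket a v, u] [w] x - v (proj F x) f * \<Theta> [a, u] [w] x"
      if "u \<in> XB" "v \<in> XB" for u v
      using f a that by (simp add: base.bracket_scale_left diff cl scale fs)
    show "partial_H F Hor \<Theta> [scale_field f a, b, c] [w] x = f (proj F x) * partial_H F Hor \<Theta> [a, b, c] [w] x"
      using f a w
      by (simp add: partial_H_3 lie_derivative_1 cl brk der br hs vs scale hlift_vertical_bracket)
        (simp add: algebra_simps)
  next
    fix a b c w x assume a: "a \<in> XB" "b \<in> XB" "c \<in> XB" and w: "w \<in> VF"
    have neg: "\<Theta> [- u, v] = - \<Theta> [u, v]" if "u \<in> XB" "v \<in> XB" for u v
      using alternating_maps_uminus[OF base.vector_fields_diff \<Theta>[unfolded biforms_def],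
          of "[]" u "[v]"] that by simp
    note f = a w partial_H_3 lie_derivative_1 cl neg s hlift_vertical_bracket
      total.field_uminus_fun[OF hlift_field]
    show "partial_H F Hor \<Theta> [b, a, c] [w] x = - partial_H F Hor \<Theta> [a, b, c] [w] x"
      by (simp add: f swap[of b a] base.bracket_swap[of b a])
    show "partial_H F Hor \<Theta> [a, c, b] [w] x = - partial_H F Hor \<Theta> [a, b, c] [w] x"
      by (simp add: f swap[of c b] base.bracket_swap[of c b])
  }
qed

text \<open>No derivative of a coefficient arises: the curvature, \<Theta> and its values are each
  linear over functions.\<close>

lemma partial_C_biform:
  assumes \<Theta>: "\<Theta> \<in> biforms F 1 2"
  shows "partial_C F Hor 1 \<Theta> \<in> biforms F 3 1"
proof (rule biforms_3_1I)
  have r: "\<Theta> [u + v] = \<Theta> [u] + \<Theta> [v]" if "u \<in> XB" "v \<in> XB" for u v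
    using alternating_maps_1(1)[OF base.vector_fields_diff \<Theta>[unfolded biforms_def]] that by simp
  have scale: "\<Theta> [scale_field f u] = (\<lambda>ws. (f \<circ> proj F) * \<Theta> [u] ws)"
    if "f \<in> SB" "u \<in> XB" for f u
    using alternating_maps_scale[OF base.vector_fields_diff \<Theta>[unfolded biforms_def], of "[]" u "[]" f]
      that by simp
  have vf: "\<Theta> [u] \<in> vertical_forms F 2" if "u \<in> XB" for u
    using biforms_vertical[OF \<Theta>, of "[u]"] that by simp
  have vr: "\<Theta> [u] [w + z, y] = \<Theta> [u] [w, y] + \<Theta> [u] [z, y]" "\<Theta> [u] [- w, y] = - \<Theta> [u] [w, y]"
    if "u \<in> XB" "w \<in> VF" "z \<in> VF" "y \<in> VF" for u w z y
    using alternating_maps_2[OF vertical_diff vf[unfolded vertical_forms_def]] that by simp_all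
  have vs: "\<Theta> [u] [scale_field f w, y] = f * \<Theta> [u] [w, y]"
    if "u \<in> XB" "w \<in> VF" "y \<in> VF" "f \<in> SM" for u w f y
    using alternating_maps_scale[OF vertical_diff vf[unfolded vertical_forms_def], of u "[]" w "[y]" f]
      that by simp
  note C = partial_C_3 interior_product_def curvature_vertical
  {
    fix a b c assume "a \<in> XB" "b \<in> XB" "c \<in> XB"
    then show "partial_C F Hor 1 \<Theta> [a, b, c] \<in> vertical_forms F 1"
      by (simp add: partial_C_3 vertical_forms_closed interior_product_vertical_form1
          curvature_vertical vf del: One_nat_def)
  next
    fix vs assume vs: "\<not> (length vs = 3 \<and> set vs \<subseteq> XB)"
    show "partial_C F Hor 1 \<Theta> vs = 0"
    proof (cases "set vs \<subseteq> XB")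
      case True
      have "\<Theta> (omit i (omit j vs)) = 0" if "j < length vs" "i < j" for i j
        by (rule biforms_outside[OF \<Theta>]) (use that True vs in \<open>auto simp: length_omit\<close>)
      then show ?thesis
        by (intro ext) (auto simp: partial_C_def interior_product_def intro!: sum.neutral)
    qed (simp add: partial_C_def fun_eq_iff)
  next
    fix a a' b c w x assume "a \<in> XB" "a' \<in> XB" "b \<in> XB" "c \<in> XB" "w \<in> VF"
    then show "partial_C F Hor 1 \<Theta> [a + a', b, c] [w] x =
        partial_C F Hor 1 \<Theta> [a, b, c] [w] x + partial_C F Hor 1 \<Theta> [a', b, c] [w] x"
      by (simp add: C r vr curvature_add_left base.vector_fields_closed del: One_nat_def)
  next
    fix f a b c w x assume "f \<in> SB" "a \<in> XB" "b \<in> XB" "c \<in> XB" "w \<in> VF"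
    then show "partial_C F Hor 1 \<Theta> [scale_field f a, b, c] [w] x =
        f (proj F x) * partial_C F Hor 1 \<Theta> [a, b, c] [w] x"
      by (simp add: C scale vs curvature_scale_left base.vector_fields_closed algebra_simps
          del: One_nat_def)
  next
    fix a b c w x assume a: "a \<in> XB" "b \<in> XB" "c \<in> XB" and w: "w \<in> VF"
    show "partial_C F Hor 1 \<Theta> [b, a, c] [w] x = - partial_C F Hor 1 \<Theta> [a, b, c] [w] x"
      using curvature_swap[of a b] a w by (simp add: C vr del: One_nat_def)
    show "partial_C F Hor 1 \<Theta> [a, c, b] [w] x = - partial_C F Hor 1 \<Theta> [a, b, c] [w] x"
      using curvature_swap[of b c] a w by (simp add: C vr del: One_nat_def)
  }
qed


section \<open>The obstruction cocycle\<close>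

text \<open>The zero form is taken in degree 0, but \<open>vertical_d\<close> carries no degree, so
  the equation serves all degrees.\<close>

lemma vertical_d_zero: "vertical_d F 0 = 0"
proof -
  have "0 \<in> vertical_forms F 0"
    by (simp add: vertical_forms_def alternating_maps_def total.smooth_zero)
  from vertical_d_diff[OF this this] show ?thesis by simp
qed

text \<open>The vertical differential of a 1-form lives on pairs; on all other argument lists
  default values give 0.\<close>

lemma Z1_3_1I:
  assumes \<Theta>: "\<Theta> \<in> biforms F 3 1"
    and d: "\<And>a b c w z x. a \<in> XB \<Longrightarrow> b \<in> XB \<Longrightarrow> c \<in> XB \<Longrightarrow> w \<in> VF \<Longrightarrow> z \<in> VF \<Longrightarrow>
      vertical_d F (\<Theta> [a, b, c]) [w, z] x = 0"
  shows "\<Theta> \<in> Z1 F 3 1"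
proof -
  have "vertical_d F (\<Theta> vs) ws x = 0" for vs ws x
  proof (cases "length vs = 3 \<and> set vs \<subseteq> XB")
    case True
    then obtain a b c where vs: "vs = [a, b, c]" "a \<in> XB" "b \<in> XB" "c \<in> XB"
      by (auto simp: numeral_3_eq_3 length_Suc_conv)
    show ?thesis
    proof (cases "length ws = 2 \<and> set ws \<subseteq> VF")
      case True
      then obtain w z where "ws = [w, z]" "w \<in> VF" "z \<in> VF"
        by (auto simp: numeral_2_eq_2 length_Suc_conv)
      then show ?thesis using d vs by simp
    next
      case False
      then have "vertical_d F (\<Theta> vs) ws = 0"
        using vertical_d_outside[OF biforms_vertical[OF \<Theta>], of vs ws] True by (simp add: numeral_2_eq_2)
      then show ?thesis by simp
    qed
  next
    case False
    then show ?thesis using biforms_outside[OF \<Theta>] by (simp add: vertical_d_zero)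
  qed
  then have "partial_V F 3 \<Theta> = 0" by (simp add: partial_V_def fun_eq_iff)
  then show ?thesis using \<Theta> by (simp add: Z1_def)
qed

lemma lie_smooth:
  assumes "X \<in> normaliser" "\<eta> \<in> vertical_forms F 2" "w \<in> VF" "z \<in> VF"
  shows "lie X \<eta> [w, z] \<in> SM"
proof -
  have "lie X \<eta> [w, z] = (\<lambda>x. X x (\<eta> [w, z])) - \<eta> [bracket X w, z] - \<eta> [w, bracket X z]"
    using assms by (simp add: fun_eq_iff lie_derivative_2)
  then show ?thesis
    using assms vertical_forms_smooth'[OF assms(2)]
    by (simp add: total.smooth_diff total.field_smooth normaliserD)
qed

text \<open>Serves to split the Lie derivative along \<open>bracket (h u) (h v)\<close> into a part
  along a lift and a part along the curvature.\<close>

lemma lie_add_field: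
  assumes "\<eta> \<in> vertical_forms F 2" "X \<in> normaliser" "Y \<in> VF" "w \<in> VF" "z \<in> VF"
  shows "lie (X + Y) \<eta> [w, z] x = lie X \<eta> [w, z] x + lie Y \<eta> [w, z] x"
proof -
  note XM = normaliserD(1)[OF assms(2)] vertical_field[OF assms(3)]
  note r = alternating_maps_2[OF vertical_diff assms(1)[unfolded vertical_forms_def]]
  show ?thesis
    using assms by (simp add: lie_derivative_2 total.bracket_add_left XM vertical_field r
        normaliserD vertical_bracket)
qed

lemma obstruction_closed:
  assumes \<Phi>: "\<Phi> \<in> vertical_forms F 3" and \<alpha>: "\<alpha> \<in> biforms F 1 2" and \<omega>: "\<omega> \<in> biforms F 2 1"
    and H\<Phi>: "partial_H F Hor (vform \<Phi>) = 0" and V\<alpha>: "partial_V F 1 \<alpha> = 0"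
    and CHV: "partial_C F Hor 0 (vform \<Phi>) + partial_H F Hor \<alpha> + partial_V F 2 \<omega> = 0"
  shows "partial_H F Hor \<omega> + partial_C F Hor 1 \<alpha> \<in> Z1 F 3 1"
proof (rule Z1_3_1I)
  show "partial_H F Hor \<omega> + partial_C F Hor 1 \<alpha> \<in> biforms F 3 1"
    by (intro biforms_add partial_H_biform[OF \<omega>] partial_C_biform[OF \<alpha>])
next
  fix a b c w z x
  assume abc: "a \<in> XB" "b \<in> XB" "c \<in> XB" and w: "w \<in> VF" and z: "z \<in> VF"
  have br: "bracket u v \<in> XB" if "u \<in> XB" "v \<in> XB" for u v
    using base.vector_fields_bracket that .
  have \<alpha>v: "\<alpha> [u] \<in> vertical_forms F 2" if "u \<in> XB" for u
    using biforms_vertical[OF \<alpha>, of "[u]"] that by simp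
  have \<omega>v: "\<omega> [u, v] \<in> vertical_forms F 1" if "u \<in> XB" "v \<in> XB" for u v
    using biforms_vertical[OF \<omega>, of "[u, v]"] that by simp
  have d\<alpha>: "vertical_d F (\<alpha> [u]) ws y = 0" for u ws y
    using fun_cong[OF fun_cong[OF fun_cong[OF V\<alpha>, of "[u]"], of ws], of y]
    by (simp add: partial_V_def)
  \<comment> \<open>On a single base field \<open>partial_H\<close> is the Lie derivative, so a
    2-plectic connection leaves \<Phi> invariant along horizontal lifts.\<close>
  have L\<Phi>: "lie (h u) \<Phi> ws y = 0" if "u \<in> XB" for u ws y
    using fun_cong[OF fun_cong[OF fun_cong[OF H\<Phi>, of "[u]"], of ws], of y] that
    by (simp add: partial_H_1 vform_def)
  \<comment> \<open>\<open>CHV\<close> solved for its last term: the sign of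
    \<open>partial_V\<close> is + in horizontal degree 2, and \<open>partial_C\<close> on \<Phi>
    contributes a minus that turns into + on the right.\<close>
  have d\<omega>: "vertical_d F (\<omega> [u, v]) [p, q] =
      (\<lambda>y. \<Phi> [curv u v, p, q] y - lie (h u) (\<alpha> [v]) [p, q] y + lie (h v) (\<alpha> [u]) [p, q] y
        + \<alpha> [bracket u v] [p, q] y)" if "u \<in> XB" "v \<in> XB" for u v p q
    using fun_cong[OF fun_cong[OF fun_cong[OF CHV, of "[u, v]"], of "[p, q]"]] that
    by (intro ext) (simp add: partial_C_2 partial_H_2 partial_V_def vform_def add_eq_0_iff
        algebra_simps)
  have Ld\<omega>: "lie (h t) (vertical_d F (\<omega> [u, v])) [w, z] x =
      \<Phi> [bracket (h t) (curv u v), w, z] x - lie (h t) (lie (h u) (\<alpha> [v])) [w, z] x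
      + lie (h t) (lie (h v) (\<alpha> [u])) [w, z] x + lie (h t) (\<alpha> [bracket u v]) [w, z] x"
    if tuv: "t \<in> XB" "u \<in> XB" "v \<in> XB" for t u v
  proof -
    note s = vertical_forms_smooth'[OF \<Phi>] lie_smooth[OF normaliser_hlift \<alpha>v]
      vertical_forms_smooth'[OF \<alpha>v]
    \<comment> \<open>Invariance of \<Phi> moves the Lie derivative entirely onto the curvature,
      which prepares the Bianchi identity.\<close>
    have i: "lie (h t) (interior_product (curv u v) \<Phi>) [w, z] x = \<Phi> [bracket (h t) (curv u v), w, z] x"
      using tuv w z by (intro lie_interior_product curvature_vertical L\<Phi>)
    show ?thesis
      \<comment> \<open>Only the derivative along \<open>h t\<close> is expanded; the inner Lie
        derivatives of \<alpha> stay folded so that \<open>comm\<close> can later match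
        them.\<close>
      unfolding i[symmetric] using tuv w z
      by (simp add: lie_derivative_2[where X = "h t"] d\<omega> interior_product_def s br
          hlift_vertical_bracket total.smooth_algebra total.field_rules[OF hlift_field[OF tuv(1)]])
  qed
  have comm: "lie (h u) (lie (h v) (\<alpha> [t])) [w, z] x - lie (h v) (lie (h u) (\<alpha> [t])) [w, z] x =
      lie (h (bracket u v)) (\<alpha> [t]) [w, z] x + lie (curv u v) (\<alpha> [t]) [w, z] x"
    if "u \<in> XB" "v \<in> XB" "t \<in> XB" for u v t
    using lie_commutator[OF normaliser_hlift normaliser_hlift \<alpha>v w z, of u v t x]
      lie_add_field[OF \<alpha>v normaliser_hlift curvature_vertical w z, of t "bracket u v" u v x] that br
    by (simp add: bracket_hlift)
  have dC: "vertical_d F (interior_product (curv u v) (\<alpha> [t])) [w, z] x = lie (curv u v) (\<alpha> [t]) [w, z] x"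
    if "u \<in> XB" "v \<in> XB" "t \<in> XB" for u v t
    using that w z by (intro vertical_d_interior_product curvature_vertical \<alpha>v d\<alpha>)
  have jac: "\<alpha> [bracket (bracket a b) c] [w, z] x =
      \<alpha> [bracket (bracket a c) b] [w, z] x - \<alpha> [bracket (bracket b c) a] [w, z] x"
  proof -
    have "bracket (bracket a b) c = bracket (bracket a c) b - bracket (bracket b c) a"
      using base.bracket_jacobi[OF abc] base.bracket_swap[of "bracket a c" b]
        base.bracket_swap[of "bracket b c" a] by (simp add: algebra_simps)
    then show ?thesis
      using alternating_maps_1(2)[OF base.vector_fields_diff \<alpha>[unfolded biforms_def],
          of "bracket (bracket a c) b" "bracket (bracket b c) a"] abc by (simp add: br)
  qed
  \<comment> \<open>The Bianchi identity is an equation of vertical fields; it is inserted into the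
    first slot of \<Phi>.\<close>
  have bia: "\<Phi> [bracket (h a) (curv b c), w, z] x - \<Phi> [bracket (h b) (curv a c), w, z] x
      + \<Phi> [bracket (h c) (curv a b), w, z] x - \<Phi> [curv (bracket a b) c, w, z] x
      + \<Phi> [curv (bracket a c) b, w, z] x - \<Phi> [curv (bracket b c) a, w, z] x = 0"
  proof -
    note alt = vertical_diff \<Phi>[unfolded vertical_forms_def]
    have r: "\<Phi> [u + v, w, z] = \<Phi> [u, w, z] + \<Phi> [v, w, z]" "\<Phi> [u - v, w, z] = \<Phi> [u, w, z] - \<Phi> [v, w, z]"
      if "u \<in> VF" "v \<in> VF" for u v
      using alternating_maps_3[OF alt, of u v w z] that w z by simp_all
    have "\<Phi> [0, w, z] = 0" using r(2)[OF w w] by simp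
    then show ?thesis
      using arg_cong[OF bianchi[OF abc], of "\<lambda>X. \<Phi> [X, w, z] x"] abc
      by (simp add: r vertical_add vertical_diff hlift_vertical_bracket curvature_vertical br)
  qed
  have "vertical_d F ((partial_H F Hor \<omega> + partial_C F Hor 1 \<alpha>) [a, b, c]) [w, z] x =
      vertical_d F (lie (h a) (\<omega> [b, c])) [w, z] x - vertical_d F (lie (h b) (\<omega> [a, c])) [w, z] x
      + vertical_d F (lie (h c) (\<omega> [a, b])) [w, z] x - vertical_d F (\<omega> [bracket a b, c]) [w, z] x
      + vertical_d F (\<omega> [bracket a c, b]) [w, z] x - vertical_d F (\<omega> [bracket b c, a]) [w, z] x
      + vertical_d F (interior_product (curv a b) (\<alpha> [c])) [w, z] x
      - vertical_d F (interior_product (curv a c) (\<alpha> [b])) [w, z] x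
      + vertical_d F (interior_product (curv b c) (\<alpha> [a])) [w, z] x"
    using abc by (simp add: partial_H_3 partial_C_3 vertical_d_add[where q = 1]
        vertical_d_diff[where q = 1] vertical_forms_closed lie_vertical_form1 normaliser_hlift \<omega>v br
        interior_product_vertical_form1 curvature_vertical \<alpha>v del: One_nat_def)
  \<comment> \<open>\<open>comm\<close> turns the double Lie derivatives into derivatives along
    lifted brackets, which cancel with those in \<open>d\<omega>\<close> at a bracket, and along the
    curvature, which cancel with \<open>dC\<close>. Single derivatives of \<alpha> at a bracket
    cancel in pairs; \<open>jac\<close> and \<open>bia\<close> remove the rest.\<close>
  also have "\<dots> = 0"
    using abc w z comm[of a b c] comm[of a c b] comm[of b c a] jac bia
    by (simp add: vertical_d_lie normaliser_hlift \<omega>v Ld\<omega> d\<omega> dC br del: One_nat_def)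
  finally show "vertical_d F ((partial_H F Hor \<omega> + partial_C F Hor 1 \<alpha>) [a, b, c]) [w, z] x = 0" .
qed


section \<open>Closed extensions\<close>

text \<open>Supplies the primitive for the exactness proof. Linearity over base functions passes
  through \<open>h\<close>, which turns a coefficient into its pullback.\<close>

lemma component_biform_0:
  assumes \<Phi>: "\<Phi> \<in> differential_forms (total_atlas F) p"
  shows "component F Hor p 0 \<Phi> \<in> biforms F p 0"
proof -
  have alt: "\<And>xs. length xs = p \<Longrightarrow> set xs \<subseteq> XM \<Longrightarrow> \<Phi> xs \<in> SM"
    "\<And>xs i a b. length xs = p \<Longrightarrow> set xs \<subseteq> XM \<Longrightarrow> i < p \<Longrightarrow> a \<in> XM \<Longrightarrow> b \<in> XM \<Longrightarrow>
      \<Phi> (xs[i := a + b]) = \<Phi> (xs[i := a]) + \<Phi> (xs[i := b])"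
    "\<And>xs i r a. length xs = p \<Longrightarrow> set xs \<subseteq> XM \<Longrightarrow> i < p \<Longrightarrow> r \<in> SM \<Longrightarrow> a \<in> XM \<Longrightarrow>
      \<Phi> (xs[i := scale_field r a]) = r * \<Phi> (xs[i := a])"
    "\<And>xs i j. length xs = p \<Longrightarrow> set xs \<subseteq> XM \<Longrightarrow> i < j \<Longrightarrow> j < p \<Longrightarrow> xs ! i = xs ! j \<Longrightarrow> \<Phi> xs = 0"
    using \<Phi> unfolding differential_forms_def alternating_maps_def by blast+
  have up: "set (xs[i := a]) \<subseteq> XB" if "set xs \<subseteq> XB" "a \<in> XB" for xs i a
    using set_update_subset_insert[of xs i a] that by auto
  have hs: "h ` set xs \<subseteq> XM" if "set xs \<subseteq> XB" for xs
    using that hlift_field by auto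
  have c: "component F Hor p 0 \<Phi> vs = (\<lambda>ws. if ws = [] then \<Phi> (map h vs) else 0)"
    if "length vs = p" "set vs \<subseteq> XB" for vs
    using that by (auto simp: component_def fun_eq_iff)
  \<comment> \<open>A vertical form of degree 0 is a smooth function placed at the empty
    list.\<close>
  have v0: "(\<lambda>ws. if ws = [] then f else 0) \<in> vertical_forms F 0" if "f \<in> SM" for f
    using that by (auto simp: vertical_forms_def alternating_maps_def)
  show ?thesis
    unfolding biforms_def alternating_maps_def
  proof (intro CollectI conjI allI impI; (elim conjE)?)
    fix xs assume "length xs = p" "set xs \<subseteq> XB"
    then show "component F Hor p 0 \<Phi> xs \<in> vertical_forms F 0"
      by (simp add: c v0 alt(1) hs)
  next
    fix xs assume "\<not> (length xs = p \<and> set xs \<subseteq> XB)"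
    then show "component F Hor p 0 \<Phi> xs = 0" by (auto simp: component_def fun_eq_iff)
  next
    fix xs i a b assume "length xs = p" "set xs \<subseteq> XB" "i < p" "a \<in> XB" "b \<in> XB"
    then show "component F Hor p 0 \<Phi> (xs[i := a + b]) =
        component F Hor p 0 \<Phi> (xs[i := a]) + component F Hor p 0 \<Phi> (xs[i := b])"
      by (simp add: c up base.vector_fields_add map_update hlift_add alt(2) hs hlift_field fun_eq_iff)
  next
    fix xs i r a assume "length xs = p" "set xs \<subseteq> XB" "i < p" "r \<in> SB" "a \<in> XB"
    then show "component F Hor p 0 \<Phi> (xs[i := scale_field r a]) =
        (\<lambda>ws. (r \<circ> proj F) * component F Hor p 0 \<Phi> (xs[i := a]) ws)"
      by (simp add: c up base.vector_fields_scale map_update hlift_scale alt(3) hs hlift_field fun_eq_iff)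
  next
    fix xs :: "'b vfield list" and i j
    assume "length xs = p" "set xs \<subseteq> XB" "i < j" "j < p" "xs ! i = xs ! j"
    then have "\<Phi> (map h xs) = 0" using alt(4)[of "map h xs" i j] hs by simp
    with \<open>length xs = p\<close> \<open>set xs \<subseteq> XB\<close> show "component F Hor p 0 \<Phi> xs = 0"
      by (simp add: c fun_eq_iff)
  qed
qed

lemma closed_extension_obstruction:
  assumes \<Phi>: "\<Phi> \<in> differential_forms (total_atlas F) 3"
    and d: "exterior_derivative (total_atlas F) \<Phi> = 0"
    and \<alpha>: "component F Hor 1 2 \<Phi> = \<alpha>" "\<alpha> \<in> biforms F 1 2"
    and \<omega>: "component F Hor 2 1 \<Phi> = \<omega>" "\<omega> \<in> biforms F 2 1"
  shows "partial_H F Hor \<omega> + partial_C F Hor 1 \<alpha> \<in> B1 F 3 1"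
proof -
  let ?T = "partial_H F Hor \<omega> + partial_C F Hor 1 \<alpha>" and ?\<eta> = "component F Hor 3 0 \<Phi>"
  have T: "?T \<in> biforms F 3 1"
    by (intro biforms_add partial_H_biform[OF \<omega>(2)] partial_C_biform[OF \<alpha>(2)])
  have \<eta>: "- ?\<eta> \<in> biforms F 3 0" by (rule biforms_uminus[OF component_biform_0[OF \<Phi>]])
  note alt = total.vector_fields_diff \<Phi>[unfolded differential_forms_def]
  have add: "\<Phi> [X + Y, U, V] = \<Phi> [X, U, V] + \<Phi> [Y, U, V]"
    if "X \<in> XM" "Y \<in> XM" "U \<in> XM" "V \<in> XM" for X Y U V
    using alternating_maps_3(1)[OF alt, of X Y U V] that by simp
  have swap: "\<Phi> [X, U, V] = - \<Phi> [U, X, V]" "\<Phi> [U, X, V] = - \<Phi> [U, V, X]"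
    if "X \<in> XM" "U \<in> XM" "V \<in> XM" for X U V
    using alternating_maps_swap_3(1)[OF alt, of U X V] alternating_maps_swap_3(2)[OF alt, of V X U] that
    by blast+
  have inside: "?T [a, b, c] [w] x = partial_V F 3 (- ?\<eta>) [a, b, c] [w] x"
    if abc: "a \<in> XB" "b \<in> XB" "c \<in> XB" and w: "w \<in> VF" for a b c w x
  proof -
    have cl: "h u \<in> XM" "bracket (h u) w \<in> VF" "curv u v \<in> VF" "bracket u v \<in> XB"
      if "u \<in> XB" "v \<in> XB" for u v
      using that w hlift_field hlift_vertical_bracket curvature_vertical base.vector_fields_bracket by auto
    have comp: "\<omega> [u, v] [y] = \<Phi> [h u, h v, y]" "\<alpha> [u] [y, y'] = \<Phi> [h u, y, y']"
      "?\<eta> [a, b, c] [] = \<Phi> [h a, h b, h c]"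
      if "u \<in> XB" "v \<in> XB" "y \<in> VF" "y' \<in> VF" for u v y y'
      using that abc by (simp_all add: component_def \<alpha>(1)[symmetric] \<omega>(1)[symmetric])
    have wM: "w \<in> XM" using w by (rule vertical_field)
    \<comment> \<open>\<open>koszul\<close> puts the vertical bracket first, \<omega> expects it
      last; a cyclic permutation of three slots is even, so the sign stays.\<close>
    have lam: "\<Phi> [bracket (h u) w, h v, h t] x = \<Phi> [h v, h t, bracket (h u) w] x"
      if "u \<in> XB" "v \<in> XB" "t \<in> XB" for u v t
      using swap[of "bracket (h u) w" "h v" "h t"] that cl vertical_field by simp
    \<comment> \<open>The lifted part of the bracket feeds \<omega>. The curvature part feeds
      \<alpha> after one transposition, hence the minus.\<close>
    have mu: "\<Phi> [bracket (h u) (h v), h t, w] x = \<Phi> [h (bracket u v), h t, w] x - \<Phi> [h t, curv u v, w] x"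
      if "u \<in> XB" "v \<in> XB" "t \<in> XB" for u v t
      using swap(1)[of "curv u v" "h t" w] that cl wM vertical_field by (simp add: bracket_hlift add)
    have "exterior_derivative (total_atlas F) \<Phi> [h a, h b, h c, w] x = 0" using d by simp
    then have "h a x (\<Phi> [h b, h c, w]) - h b x (\<Phi> [h a, h c, w]) + h c x (\<Phi> [h a, h b, w])
      - w x (\<Phi> [h a, h b, h c]) - \<Phi> [bracket (h a) (h b), h c, w] x + \<Phi> [bracket (h a) (h c), h b, w] x
      - \<Phi> [bracket (h a) w, h b, h c] x - \<Phi> [bracket (h b) (h c), h a, w] x
      + \<Phi> [bracket (h b) w, h a, h c] x - \<Phi> [bracket (h c) w, h a, h b] x = 0"
      using abc wM by (simp add: exterior_derivative_def koszul_4 cl)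
    \<comment> \<open>The minus of the primitive \<open>- ?\<eta>\<close> has to come out of the
      derivative, where it meets the factor \<open>(-1) ^ 3\<close> of
      \<open>partial_V\<close>.\<close>
    moreover have "w x (- \<Phi> [h a, h b, h c]) = - w x (\<Phi> [h a, h b, h c])"
      using alternating_maps_closed[OF \<Phi>[unfolded differential_forms_def], of "[h a, h b, h c]"] abc
      by (intro total.field_uminus_fun wM) (simp add: cl)
    ultimately show ?thesis
      using abc w
      by (simp add: partial_H_3 partial_C_3 lie_derivative_1 interior_product_def partial_V_def
          vertical_d_def koszul_1 comp cl lam mu del: One_nat_def)
  qed
  have "?T vs ws = partial_V F 3 (- ?\<eta>) vs ws" for vs ws
  proof (cases "length vs = 3 \<and> set vs \<subseteq> XB")
    case True
    then obtain a b c where vs: "vs = [a, b, c]" "a \<in> XB" "b \<in> XB" "c \<in> XB"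
      by (auto simp: numeral_3_eq_3 length_Suc_conv)
    show ?thesis
    proof (cases "length ws = 1 \<and> set ws \<subseteq> VF")
      case True
      then obtain w where "ws = [w]" "w \<in> VF" by (auto simp: length_Suc_conv)
      then show ?thesis using inside vs by (simp add: fun_eq_iff)
    next
      case False
      then have "?T vs ws = 0"
        using vertical_forms_outside[OF biforms_vertical[OF T]] True by blast
      moreover have "vertical_d F ((- ?\<eta>) vs) ws = 0"
        using vertical_d_outside[OF biforms_vertical[OF \<eta>], of vs ws] True False by simp
      ultimately show ?thesis by (simp add: partial_V_def fun_eq_iff)
    qed
  next
    case False
    then have "?T vs = 0" "(- ?\<eta>) vs = 0"
      using biforms_outside[OF T] biforms_outside[OF \<eta>] by blast+
    then show ?thesis by (simp only: partial_V_def vertical_d_zero) (simp add: fun_eq_iff)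
  qed
  then have "?T = partial_V F 3 (- ?\<eta>)" by (intro ext) simp
  then show ?thesis unfolding B1_def using \<eta> by auto
qed

section \<open>Exact biforms and their cosets\<close>

lemma B1_add:
  assumes "\<Theta> \<in> B1 F p (Suc q)" "\<Psi> \<in> B1 F p (Suc q)"
  shows "\<Theta> + \<Psi> \<in> B1 F p (Suc q)" "\<Theta> - \<Psi> \<in> B1 F p (Suc q)"
proof -
  obtain A B where A: "A \<in> biforms F p q" "\<Theta> = partial_V F p A"
    and B: "B \<in> biforms F p q" "\<Psi> = partial_V F p B"
    using assms by (auto simp: B1_def)
  have d: "vertical_d F (A vs + B vs) = vertical_d F (A vs) + vertical_d F (B vs)"
    "vertical_d F (A vs - B vs) = vertical_d F (A vs) - vertical_d F (B vs)" for vs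
    using vertical_d_add[OF biforms_vertical[OF A(1)] biforms_vertical[OF B(1)], of vs]
      vertical_d_diff[OF biforms_vertical[OF A(1)] biforms_vertical[OF B(1)], of vs]
      biforms_outside[OF A(1), of vs] biforms_outside[OF B(1), of vs]
    by (cases "length vs = p \<and> set vs \<subseteq> XB"; simp add: vertical_d_zero)+
  have "\<Theta> + \<Psi> = partial_V F p (A + B)" "\<Theta> - \<Psi> = partial_V F p (A - B)"
    by (simp_all add: A B partial_V_def d fun_eq_iff algebra_simps)
  then show "\<Theta> + \<Psi> \<in> B1 F p (Suc q)" "\<Theta> - \<Psi> \<in> B1 F p (Suc q)"
    using biforms_add[OF A(1) B(1)] biforms_diff[OF A(1) B(1)] by (auto simp: B1_def)
qed

text \<open>The coset of a member of \<open>B1\<close> is \<open>B1\<close> itself, the unit of the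
  quotient. The successor degree selects the clause of \<open>B1\<close> given by images of
  \<open>partial_V\<close>.\<close>

lemma class1_eq_one:
  assumes "\<Theta> \<in> B1 F p (Suc q)"
  shows "class1 F p (Suc q) \<Theta> = \<one>\<^bsub>E1 F p (Suc q)\<^esub>"
proof -
  have "(\<Union>\<Psi>\<in>B1 F p (Suc q). {\<Psi> + \<Theta>}) = B1 F p (Suc q)"
  proof
    show "(\<Union>\<Psi>\<in>B1 F p (Suc q). {\<Psi> + \<Theta>}) \<subseteq> B1 F p (Suc q)"
      using B1_add(1)[OF _ assms] by auto
    show "B1 F p (Suc q) \<subseteq> (\<Union>\<Psi>\<in>B1 F p (Suc q). {\<Psi> + \<Theta>})"
    proof
      fix \<Psi> assume "\<Psi> \<in> B1 F p (Suc q)"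
      then have "\<Psi> - \<Theta> \<in> B1 F p (Suc q)" "\<Psi> = (\<Psi> - \<Theta>) + \<Theta>" using B1_add(2)[OF _ assms] by auto
      then show "\<Psi> \<in> (\<Union>\<Psi>\<in>B1 F p (Suc q). {\<Psi> + \<Theta>})" by blast
    qed
  qed
  then show ?thesis
    by (simp add: class1_def E1_def FactGroup_def additive_group_def r_coset_def)
qed

end

lemma class1_carrier: "\<Theta> \<in> Z1 F p q \<Longrightarrow> class1 F p q \<Theta> \<in> carrier (E1 F p q)"
  by (auto simp: class1_def E1_def FactGroup_def additive_group_def RCOSETS_def)

theorem proposition12:
  fixes F :: "('m::{t2_space, second_countable_topology}, 'e::real_inner,
               'b::{t2_space, second_countable_topology}, 'f::real_inner) fibred"
    and Hor :: "'m distribution"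
    and \<Phi>\<^sub>V :: "'m form"
    and \<alpha> \<omega> :: "('b, 'm) biform"
  assumes "two_plectic_fibration F \<Phi>\<^sub>V"
    and "two_plectic_connection F \<Phi>\<^sub>V Hor"
    and "class2 F Hor 2 2 (partial_C F Hor 0 (vform \<Phi>\<^sub>V)) = \<one>\<^bsub>E2 F Hor 2 2\<^esub>"
    and "\<alpha> \<in> biforms F 1 2"
    and "\<omega> \<in> biforms F 2 1"
    and "partial_H F Hor (vform \<Phi>\<^sub>V) + partial_V F 1 \<alpha> = 0"
    and "partial_C F Hor 0 (vform \<Phi>\<^sub>V) + partial_H F Hor \<alpha> + partial_V F 2 \<omega> = 0"
  shows "partial_H F Hor \<omega> + partial_C F Hor 1 \<alpha> \<in> Z1 F 3 1 \<and>
    class1 F 3 1 (partial_H F Hor \<omega> + partial_C F Hor 1 \<alpha>) \<in> carrier (E1 F 3 1) \<and>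
    ((\<exists>\<Phi>\<in>differential_forms (total_atlas F) 3.
        exterior_derivative (total_atlas F) \<Phi> = 0 \<and>
        component F Hor 0 3 \<Phi> = vform \<Phi>\<^sub>V \<and>
        component F Hor 1 2 \<Phi> = \<alpha> \<and>
        component F Hor 2 1 \<Phi> = \<omega>) \<longrightarrow>
      class1 F 3 1 (partial_H F Hor \<omega> + partial_C F Hor 1 \<alpha>) = \<one>\<^bsub>E1 F 3 1\<^esub>)"
proof -
  have pH: "partial_H F Hor (vform \<Phi>\<^sub>V) = 0" and con: "ehresmann_connection F Hor"
    using assms(2) unfolding two_plectic_connection_def by auto
  have \<Phi>: "\<Phi>\<^sub>V \<in> vertical_forms F 3" and sub: "surjective_submersion F"
    using assms(1) unfolding two_plectic_fibration_def fibration_def by auto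
  interpret ehresmann_submersion F Hor by unfold_locales (rule sub con)+
  \<comment> \<open>As \<open>partial_H\<close> annihilates the fibre form for a 2-plectic
    connection, the first equation reduces to vertical closedness of \<alpha>.\<close>
  have Z: "partial_H F Hor \<omega> + partial_C F Hor 1 \<alpha> \<in> Z1 F 3 1"
    using obstruction_closed[OF \<Phi> assms(4,5) pH _ assms(7)] assms(6) pH by simp
  moreover have "class1 F 3 1 (partial_H F Hor \<omega> + partial_C F Hor 1 \<alpha>) = \<one>\<^bsub>E1 F 3 1\<^esub>"
    if "\<Phi> \<in> differential_forms (total_atlas F) 3" "exterior_derivative (total_atlas F) \<Phi> = 0"
      "component F Hor 1 2 \<Phi> = \<alpha>" "component F Hor 2 1 \<Phi> = \<omega>" for \<Phi>
    using class1_eq_one[of _ 3 0] closed_extension_obstruction[OF that(1,2,3) assms(4) that(4) assms(5)]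
    by simp
  ultimately show ?thesis using class1_carrier[OF Z] by blast
qed

end
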